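(* Let $n$ be a positive integer and let $\{y_I\}$ be a collection of nonnegative real numbers indexed by the nonempty subsets $I\subseteq[n]$. For any distinct real numbers $\lambda_1,\dots,\lambda_n$, we have $$\mathrm{Vol}\,P_n^y(\{y_I\})=\frac{1}{(n-1)!}\sum_{w\in S_n}\frac{\Bigl(\sum_{I\subseteq[n]}\lambda_{w(\min(I))}\,y_{w(I)}\Bigr)^{n-1}}{(\lambda_{w(1)}-\lambda_{w(2)})\cdots(\lambda_{w(n-1)}-\lambda_{w(n)})},$$ where the inner sum is over nonempty subsets $I$ of $[n]$.
   Context: $[n]=\{1,\dots,n\}$, $S_n$ is the symmetric group, $w(I)=\{w(i)\mid i\in I\}$. For nonempty $I\subseteq[n]$, $\Delta_I=\mathrm{ConvexHull}(e_i\mid i\in I)\subset\mathbb{R}^n$, with $e_i$ the coordinate vectors. The generalized permutohedron is the Minkowski sum $P_n^y(\{y_I\})=\sum_{\emptyset\neq I\subseteq[n]}y_I\,\Delta_I$; it lies in a hyperplane $t_1+\cdots+t_n=c$. $\mathrm{Vol}$ denotes the usual $(n-1)$-dimensional volume of the image under the projection $(t_1,\dots,t_n)\mapsto(t_1,\dots,t_{n-1})$ (for $n=1$ the volume of a point is $1$). Convention: $z^0=1$, and empty products are $1$. *)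

theory Defs
  imports
    "HOL-Analysis.Analysis"
    "HOL-Analysis.Finite_Function_Topology"
    "HOL-Combinatorics.Permutations"
    "HOL-Library.Set_Algebras"
begin

text \<open>
  Points are finitely supported functions on \<open>nat\<close>; this type carries the library's
  real vector space structure (hence \<open>convex hull\<close>), and \<open>\<real>\<^sup>n\<close> is the subspace
  of functions supported on \<open>{1..n}\<close>.
\<close>

definition unit_vec :: "nat \<Rightarrow> (nat \<Rightarrow>\<^sub>0 real)" where
  "unit_vec i = Poly_Mapping.single i 1"

definition coord_simplex :: "nat set \<Rightarrow> (nat \<Rightarrow>\<^sub>0 real) set" where
  "coord_simplex I = convex hull (unit_vec ` I)"

definition nonempty_subsets :: "nat \<Rightarrow> nat set set" where
  "nonempty_subsets n = {I. I \<noteq> {} \<and> I \<subseteq> {1..n}}"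

text \<open>The sum below is the Minkowski sum of sets (addition of sets from \<open>Set_Algebras\<close>).\<close>

definition gen_permutohedron :: "nat \<Rightarrow> (nat set \<Rightarrow> real) \<Rightarrow> (nat \<Rightarrow>\<^sub>0 real) set" where
  "gen_permutohedron n y =
     (\<Sum>I\<in>nonempty_subsets n. (\<lambda>t. y I *\<^sub>R t) ` coord_simplex I)"

text \<open>
  The projection forgets the \<open>n\<close>-th coordinate; its values are functions on \<open>{1..<n}\<close>
  (\<open>undefined\<close> elsewhere), as in the carrier of \<^term>\<open>Pi\<^sub>M {1..<n} (\<lambda>_. lborel)\<close>.
  For \<open>n = 1\<close> this product measure is the unit point mass, so a point has volume 1.
\<close>

definition drop_last_coord :: "nat \<Rightarrow> (nat \<Rightarrow>\<^sub>0 real) \<Rightarrow> nat \<Rightarrow> real" where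
  "drop_last_coord n t = restrict (Poly_Mapping.lookup t) {1..<n}"

definition Vol :: "nat \<Rightarrow> (nat \<Rightarrow>\<^sub>0 real) set \<Rightarrow> real" where
  "Vol n P = measure (Pi\<^sub>M {1..<n} (\<lambda>_. lborel)) (drop_last_coord n ` P)"

end

theory Submission
  imports Defs "HOL-Combinatorics.Multiset_Permutations" "HOL-Computational_Algebra.Polynomial"
begin

text \<open>
  Let \<open>z S\<close> be the sum of the \<open>y I\<close> with \<open>I\<close> meeting \<open>S\<close>, a submodular function. By a transport
  (supply-demand) argument the polytope consists of the points \<open>t\<close> of the hyperplane whose slack
  \<open>D S = z S - t S\<close> is nonnegative for every \<open>S\<close>. Its indicator function is the signed sum over all
  permutations \<open>w\<close> of the indicator functions of the tangent cones at the vertices, flipped so that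
  \<open>lam\<close> is bounded above on them: expanding the product over the chain \<open>w ` {1..i}\<close> turns this
  sum into a reduced Euler characteristic of the family \<open>{S. D S < 0}\<close>, which is conically contractible
  when nonempty, since it is closed under joining a minimiser of \<open>D\<close>. The slacks along the chain are
  volume preserving coordinates, so intersecting with a half-space \<open>lam \<bullet> t \<ge> - R\<close> yields
  simplices of volume \<open>(R + L w) ^ (n - 1) / ((n - 1)! \<Prod> \<bar>lam (w i) - lam (w (i + 1))\<bar>)\<close>, with \<open>L w\<close> the
  value of \<open>lam\<close> at the vertex. For all large \<open>R\<close> the signed sum is the volume; being polynomial in \<open>R\<close>,
  it is constant, and \<open>R = 0\<close> gives the formula.
\<close>

section \<open>Transport with supports\<close>

text \<open>The inductive step at a tight set \<open>S\<close>: every \<open>f\<close> whose support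
  meets \<open>S\<close> has to send its whole supply into \<open>S\<close>, so the problem
  decouples into one on \<open>S\<close>, with supports cut down to \<open>S\<close>, and one on
  \<open>G - S\<close>. The induction hypothesis appears as the assumption \<open>IH\<close>, which
  makes the step usable for any demand vector.\<close>

lemma transport_split:
  fixes y :: "'f \<Rightarrow> real" and t :: "'g \<Rightarrow> real"
  assumes G: "finite G" and F: "finite F"
    and sub: "\<And>f. f \<in> F \<Longrightarrow> I f \<subseteq> G"
    and ne: "\<And>f. f \<in> F \<Longrightarrow> I f \<noteq> {}"
    and tot: "(\<Sum>g\<in>G. t g) = (\<Sum>f\<in>F. y f)"
    and le: "\<And>S. S \<subseteq> G \<Longrightarrow> (\<Sum>g\<in>S. t g) \<le> (\<Sum>f | f \<in> F \<and> I f \<inter> S \<noteq> {}. y f)"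
    and S: "S \<subseteq> G" and tight: "(\<Sum>g\<in>S. t g) = (\<Sum>f | f \<in> F \<and> I f \<inter> S \<noteq> {}. y f)"
    and IH: "\<And>H F' J. H = S \<or> H = G - S \<Longrightarrow> F' \<subseteq> F \<Longrightarrow>
       (\<And>f. f \<in> F' \<Longrightarrow> J f \<subseteq> H \<and> J f \<noteq> {}) \<Longrightarrow>
       (\<Sum>g\<in>H. t g) = (\<Sum>f\<in>F'. y f) \<Longrightarrow>
       (\<And>T. T \<subseteq> H \<Longrightarrow> (\<Sum>g\<in>T. t g) \<le> (\<Sum>f | f \<in> F' \<and> J f \<inter> T \<noteq> {}. y f)) \<Longrightarrow>
       \<exists>x. (\<forall>f\<in>F'. \<forall>g\<in>H. (0::real) \<le> x f g \<and> (g \<notin> J f \<longrightarrow> x f g = 0)) \<and>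
           (\<forall>f\<in>F'. (\<Sum>g\<in>H. x f g) = y f) \<and> (\<forall>g\<in>H. (\<Sum>f\<in>F'. x f g) = t g)"
  shows "\<exists>x. (\<forall>f\<in>F. \<forall>g\<in>G. (0::real) \<le> x f g \<and> (g \<notin> I f \<longrightarrow> x f g = 0)) \<and>
           (\<forall>f\<in>F. (\<Sum>g\<in>G. x f g) = y f) \<and> (\<forall>g\<in>G. (\<Sum>f\<in>F. x f g) = t g)"
proof -
  define F1 where "F1 = {f \<in> F. I f \<inter> S \<noteq> {}}"
  define F2 where "F2 = {f \<in> F. I f \<inter> S = {}}"
  have F12: "F = F1 \<union> F2" "F1 \<inter> F2 = {}" "finite F1" "finite F2"
    using F by (auto simp: F1_def F2_def)
  have GS: "G = S \<union> (G - S)" "S \<inter> (G - S) = {}" "finite S" "finite (G - S)"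
    using G S by (auto intro: finite_subset)
  have splitG: "sum h G = sum h S + sum h (G - S)" for h :: "'g \<Rightarrow> real"
    using GS by (metis sum.union_disjoint)
  have splitF: "sum h F = sum h F1 + sum h F2" for h :: "'f \<Rightarrow> real"
    using F12 by (metis sum.union_disjoint)
  have "\<exists>x. (\<forall>f\<in>F1. \<forall>g\<in>S. (0::real) \<le> x f g \<and> (g \<notin> I f \<inter> S \<longrightarrow> x f g = 0)) \<and>
           (\<forall>f\<in>F1. (\<Sum>g\<in>S. x f g) = y f) \<and> (\<forall>g\<in>S. (\<Sum>f\<in>F1. x f g) = t g)"
  proof (rule IH)
    show "(\<Sum>g\<in>S. t g) = (\<Sum>f\<in>F1. y f)" using tight by (simp add: F1_def)
    fix T assume T: "T \<subseteq> S"
    have "{f \<in> F. I f \<inter> T \<noteq> {}} = {f \<in> F1. I f \<inter> S \<inter> T \<noteq> {}}"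
      using T by (auto simp: F1_def)
    then show "(\<Sum>g\<in>T. t g) \<le> (\<Sum>f | f \<in> F1 \<and> I f \<inter> S \<inter> T \<noteq> {}. y f)"
      using le[of T] T S by auto
  qed (auto simp: F1_def)
  then obtain x1 where x1: "\<And>f g. f \<in> F1 \<Longrightarrow> g \<in> S \<Longrightarrow> 0 \<le> x1 f g \<and> (g \<notin> I f \<longrightarrow> x1 f g = 0)"
    "\<And>f. f \<in> F1 \<Longrightarrow> (\<Sum>g\<in>S. x1 f g) = y f" "\<And>g. g \<in> S \<Longrightarrow> (\<Sum>f\<in>F1. x1 f g) = t g"
    by (metis IntD1)
  have "\<exists>x. (\<forall>f\<in>F2. \<forall>g\<in>G - S. (0::real) \<le> x f g \<and> (g \<notin> I f \<longrightarrow> x f g = 0)) \<and>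
           (\<forall>f\<in>F2. (\<Sum>g\<in>G - S. x f g) = y f) \<and> (\<forall>g\<in>G - S. (\<Sum>f\<in>F2. x f g) = t g)"
  proof (rule IH)
    show "(\<Sum>g\<in>G - S. t g) = (\<Sum>f\<in>F2. y f)"
      using tight tot splitG[of t] splitF[of y] by (simp add: F1_def)
    fix T assume T: "T \<subseteq> G - S"
    have fT: "finite T" using T GS by (auto intro: finite_subset)
    \<comment> \<open>The inequality for \<open>T\<close> inside \<open>G - S\<close> is the one for
      \<open>S \<union> T\<close> minus the equality at \<open>S\<close>.\<close>
    have "{f \<in> F. I f \<inter> (S \<union> T) \<noteq> {}} = F1 \<union> {f \<in> F2. I f \<inter> T \<noteq> {}}"
      by (auto simp: F1_def F2_def)
    then have "(\<Sum>f | f \<in> F \<and> I f \<inter> (S \<union> T) \<noteq> {}. y f)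
        = (\<Sum>f\<in>F1. y f) + (\<Sum>f | f \<in> F2 \<and> I f \<inter> T \<noteq> {}. y f)"
      using F12 by (simp, subst sum.union_disjoint) auto
    moreover have "(\<Sum>g\<in>S \<union> T. t g) = (\<Sum>g\<in>S. t g) + (\<Sum>g\<in>T. t g)"
      using GS fT T by (subst sum.union_disjoint) auto
    ultimately show "(\<Sum>g\<in>T. t g) \<le> (\<Sum>f | f \<in> F2 \<and> I f \<inter> T \<noteq> {}. y f)"
      using le[of "S \<union> T"] T S tight by (auto simp: F1_def)
  qed (use sub ne in \<open>auto simp: F2_def\<close>)
  then obtain x2 where x2: "\<And>f g. f \<in> F2 \<Longrightarrow> g \<in> G - S \<Longrightarrow> 0 \<le> x2 f g \<and> (g \<notin> I f \<longrightarrow> x2 f g = 0)"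
    "\<And>f. f \<in> F2 \<Longrightarrow> (\<Sum>g\<in>G - S. x2 f g) = y f" "\<And>g. g \<in> G - S \<Longrightarrow> (\<Sum>f\<in>F2. x2 f g) = t g"
    by metis
  define x where "x f g = (if f \<in> F1 then if g \<in> S then x1 f g else 0
                           else if g \<in> S then 0 else x2 f g)" for f g
  have nF1: "f \<notin> F1" if "f \<in> F2" for f using F12 that by auto
  have "\<forall>f\<in>F. \<forall>g\<in>G. 0 \<le> x f g \<and> (g \<notin> I f \<longrightarrow> x f g = 0)"
    using x1(1) x2(1) F12(1) by (auto simp: x_def)
  moreover have "(\<Sum>g\<in>G. x f g) = y f" if "f \<in> F" for f
  proof (cases "f \<in> F1")
    case True then show ?thesis by (simp add: splitG x_def x1)
  next
    case False then show ?thesis using that F12(1) by (simp add: splitG x_def x2)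
  qed
  moreover have "(\<Sum>f\<in>F. x f g) = t g" if "g \<in> G" for g
  proof (cases "g \<in> S")
    case True then show ?thesis by (simp add: splitF x_def x1 nF1)
  next
    case False then show ?thesis using that by (simp add: splitF x_def x2 nF1)
  qed
  ultimately show ?thesis by blast
qed

text \<open>A fractional Hall theorem: the demand of \<open>S\<close> is compared with the total
  supply able to reach \<open>S\<close>. For a fixed supply the pairs of demand and solution are
  closed under convex combinations, so it suffices to reach demands with a tight proper subset,
  which \<open>transport_split\<close> reduces to smaller \<open>G\<close>.\<close>

lemma transport_feasible:
  fixes y :: "'f \<Rightarrow> real" and t :: "'g \<Rightarrow> real"
  assumes "finite G" "finite F"
    and "\<And>f. f \<in> F \<Longrightarrow> 0 \<le> y f"
    and "\<And>f. f \<in> F \<Longrightarrow> I f \<subseteq> G \<and> I f \<noteq> {}"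
    and "(\<Sum>g\<in>G. t g) = (\<Sum>f\<in>F. y f)"
    and "\<And>S. S \<subseteq> G \<Longrightarrow> (\<Sum>g\<in>S. t g) \<le> (\<Sum>f | f \<in> F \<and> I f \<inter> S \<noteq> {}. y f)"
  shows "\<exists>x. (\<forall>f\<in>F. \<forall>g\<in>G. 0 \<le> x f g \<and> (g \<notin> I f \<longrightarrow> x f g = 0)) \<and>
           (\<forall>f\<in>F. (\<Sum>g\<in>G. x f g) = y f) \<and> (\<forall>g\<in>G. (\<Sum>f\<in>F. x f g) = t g)"
  using assms
proof (induction "card G" arbitrary: G F I t rule: less_induct)
  case less
  note G = less.prems(1) and F = less.prems(2) and y0 = less.prems(3) and I = less.prems(4)
  define z where "z S = (\<Sum>f | f \<in> F \<and> I f \<inter> S \<noteq> {}. y f)" for S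
  define feas where "feas u \<longleftrightarrow> sum u G = sum y F \<and> (\<forall>S\<subseteq>G. sum u S \<le> z S)" for u
  define sol where "sol u x \<longleftrightarrow> (\<forall>f\<in>F. \<forall>g\<in>G. 0 \<le> x f g \<and> (g \<notin> I f \<longrightarrow> x f g = 0)) \<and>
           (\<forall>f\<in>F. (\<Sum>g\<in>G. x f g) = y f) \<and> (\<forall>g\<in>G. (\<Sum>f\<in>F. x f g) = u g)" 
           for u :: "'g \<Rightarrow> real" and x :: "'f \<Rightarrow> 'g \<Rightarrow> real"
  have feas_t: "feas t" using less.prems(5,6) by (auto simp: feas_def z_def)
  have tight: "\<exists>x. sol u x" if "feas u" "S \<subset> G" "S \<noteq> {}" "sum u S = z S" for u S
    unfolding sol_def
  proof (rule transport_split[where S = S])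
    fix H F' and J :: "'f \<Rightarrow> 'g set"
    assume H: "H = S \<or> H = G - S" and F': "F' \<subseteq> F"
      and J: "\<And>f. f \<in> F' \<Longrightarrow> J f \<subseteq> H \<and> J f \<noteq> {}" "sum u H = sum y F'"
        "\<And>T. T \<subseteq> H \<Longrightarrow> sum u T \<le> (\<Sum>f | f \<in> F' \<and> J f \<inter> T \<noteq> {}. y f)"
    have "H \<subset> G" using H that by auto
    then have cH: "card H < card G" "finite H" using G by (auto intro: psubset_card_mono finite_subset)
    show "\<exists>x. (\<forall>f\<in>F'. \<forall>g\<in>H. 0 \<le> x f g \<and> (g \<notin> J f \<longrightarrow> x f g = 0)) \<and>
           (\<forall>f\<in>F'. (\<Sum>g\<in>H. x f g) = y f) \<and> (\<forall>g\<in>H. (\<Sum>f\<in>F'. x f g) = u g)"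
      by (rule less.hyps[OF cH]) (use F F' y0 J in \<open>auto intro: finite_subset\<close>)
  qed (use that G F I in \<open>auto simp: feas_def z_def\<close>)
  have conv: "sol (\<lambda>g. p * u g + q * v g) (\<lambda>f g. p * a f g + q * b f g)"
    if "sol u a" "sol v b" "p \<ge> 0" "q \<ge> 0" "p + q = 1" for u v a b p q
  proof -
    have "p * c + q * c = c" for c using that(5) by (metis distrib_right mult_1)
    then show ?thesis using that
      by (auto simp: sol_def sum.distrib simp flip: sum_distrib_left)
  qed
  show ?case
  proof (cases "\<exists>i\<in>G. \<exists>j\<in>G. i \<noteq> j")
    case False
    then have "G = {g}" if "g \<in> G" for g using that by blast
    then have "G = {} \<or> (\<exists>g. G = {g})" by blast
    then show ?thesis
    proof
      assume "G = {}" then have "F = {}" using I by auto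
      then show ?thesis using \<open>G = {}\<close> by auto
    next
      assume "\<exists>g. G = {g}"
      then obtain g where g: "G = {g}" by auto
      then have "I f = {g}" if "f \<in> F" for f using I[OF that] by auto
      then show ?thesis using y0 g less.prems(5)
        by (intro exI[of _ "\<lambda>f g. y f"]) auto
    qed
  next
    case True
    show ?thesis
    proof (cases "\<exists>S. S \<subset> G \<and> S \<noteq> {} \<and> sum t S = z S")
      case True
      then show ?thesis using tight[OF feas_t] unfolding sol_def by blast
    next
      case False
      \<comment> \<open>Moving along \<open>e\<^sub>i - e\<^sub>j\<close> in both directions until some set becomes tight exhibits \<open>t\<close> as a
        convex combination of two points of the case already treated.\<close>
      have move: "\<exists>a>0. \<exists>x. sol (\<lambda>g. t g + a * (of_bool (g = i) - of_bool (g = j))) x"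
        if ij: "i \<in> G" "j \<in> G" "i \<noteq> j" for i j
      proof -
        \<comment> \<open>The sets in this family are those whose demand grows along the move from
          \<open>j\<close> to \<open>i\<close>. The least slack \<open>a\<close> among them is the
          longest feasible step; it is positive because no proper nonempty set is tight, and it
          makes the minimiser \<open>S0\<close> tight.\<close>
        define \<C> where "\<C> = {S. S \<subseteq> G \<and> i \<in> S \<and> j \<notin> S}"
        have C: "finite \<C>" "{i} \<in> \<C>" using G ij by (auto simp: \<C>_def)
        define a where "a = Min ((\<lambda>S. z S - sum t S) ` \<C>)"
        have "a \<in> (\<lambda>S. z S - sum t S) ` \<C>" unfolding a_def using C by (intro Min_in) auto
        then obtain S0 where S0: "S0 \<in> \<C>" "a = z S0 - sum t S0" by auto
        have a_le: "a \<le> z S - sum t S" if "S \<in> \<C>" for S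
          unfolding a_def using C that by (intro Min_le) auto
        have S0': "S0 \<subset> G" "S0 \<noteq> {}" using S0 ij by (auto simp: \<C>_def)
        then have "sum t S0 \<noteq> z S0" using False by auto
        moreover have "sum t S0 \<le> z S0" using feas_t S0' by (auto simp: feas_def)
        ultimately have a0: "a > 0" using S0 by auto
        define u where "u = (\<lambda>g. t g + a * (of_bool (g = i) - of_bool (g = j)))"
        have su: "sum u S = sum t S + a * (of_bool (i \<in> S) - of_bool (j \<in> S))" if "S \<subseteq> G" for S
        proof -
          have "finite S" using that G by (auto intro: finite_subset)
          then show ?thesis
            by (simp add: u_def sum.distrib sum_subtractf of_bool_def flip: sum_distrib_left)
        qed
        have "feas u"
          unfolding feas_def
        proof (intro conjI allI impI)
          show "sum u G = sum y F" using ij less.prems(5) by (simp add: su)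
          fix S assume S: "S \<subseteq> G"
          have "sum t S \<le> z S" using feas_t S by (auto simp: feas_def)
          then show "sum u S \<le> z S" using S a0 a_le[of S]
            by (cases "i \<in> S"; cases "j \<in> S") (auto simp: su \<C>_def)
        qed
        moreover have "sum u S0 = z S0" using S0 S0' by (simp add: su \<C>_def)
        ultimately have "\<exists>x. sol u x" using S0' tight by blast
        then show ?thesis using a0 unfolding u_def by blast
      qed
      from True obtain i j where ij: "i \<in> G" "j \<in> G" "i \<noteq> j" by auto
      obtain a x where a: "a > 0" "sol (\<lambda>g. t g + a * (of_bool (g = i) - of_bool (g = j))) x"
        using move[OF ij] by blast
      obtain b x' where b: "b > 0" "sol (\<lambda>g. t g + b * (of_bool (g = j) - of_bool (g = i))) x'"
        using move[of j i] ij by blast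
      \<comment> \<open>These weights make the displacements \<open>a\<close> and \<open>b\<close>
        in opposite directions cancel.\<close>
      have "sol (\<lambda>g. b / (a + b) * (t g + a * (of_bool (g = i) - of_bool (g = j))) +
          a / (a + b) * (t g + b * (of_bool (g = j) - of_bool (g = i))))
          (\<lambda>f g. b / (a + b) * x f g + a / (a + b) * x' f g)"
      proof (rule conv[OF a(2) b(2)])
        show "b / (a + b) + a / (a + b) = 1"
          using a(1) b(1) by (simp add: add.commute flip: add_divide_distrib)
      qed (use a(1) b(1) in auto)
      moreover have "b / (a + b) * (t g + a * (of_bool (g = i) - of_bool (g = j))) +
          a / (a + b) * (t g + b * (of_bool (g = j) - of_bool (g = i))) = t g" for g
      proof -
        define d :: real where "d = of_bool (g = i) - of_bool (g = j)"
        have d: "of_bool (g = j) - of_bool (g = i) = - d" by (simp add: d_def)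
        have "b / (a + b) * (t g + a * d) + a / (a + b) * (t g + b * - d)
            = (b * (t g + a * d) + a * (t g + b * - d)) / (a + b)"
          by (simp add: add_divide_distrib diff_divide_distrib)
        also have "\<dots> = (a + b) * t g / (a + b)" by (simp add: algebra_simps)
        also have "\<dots> = t g" using a(1) b(1) by (intro nonzero_mult_div_cancel_left) simp
        finally show ?thesis unfolding d by (simp only: d_def)
      qed
      ultimately have "sol t (\<lambda>f g. b / (a + b) * x f g + a / (a + b) * x' f g)" by simp
      then show ?thesis unfolding sol_def
        by (intro exI[of _ "\<lambda>f g. b / (a + b) * x f g + a / (a + b) * x' f g"])
    qed
  qed
qed

section \<open>Signed sums over permutations\<close>

text \<open>The list holds \<open>w 1, ..., w n\<close>; for the recursion the prefix sets of \<open>w\<close> are replaced by their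
  complements, the suffix sets, so \<open>N\<close> stands for the complements of the sets with negative slack.\<close>

fun desc_weight :: "('a \<Rightarrow> real) \<Rightarrow> 'a set set \<Rightarrow> 'a list \<Rightarrow> real" where
  "desc_weight lam N (x # y # r) =
     (of_bool (lam y < lam x) - of_bool (set (y # r) \<in> N)) * desc_weight lam N (y # r)"
| "desc_weight lam N xs = 1"

definition desc_sum :: "('a \<Rightarrow> real) \<Rightarrow> 'a set set \<Rightarrow> 'a set \<Rightarrow> real" where
  "desc_sum lam N A = (\<Sum>xs\<in>permutations_of_set A. desc_weight lam N xs)"

text \<open>The head is a parameter because the first factor of the weight compares it with the
  second entry.\<close>

definition desc_sum_hd :: "('a \<Rightarrow> real) \<Rightarrow> 'a set set \<Rightarrow> 'a set \<Rightarrow> 'a \<Rightarrow> real" where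
  "desc_sum_hd lam N A x = (\<Sum>r\<in>permutations_of_set (A - {x}). desc_weight lam N (x # r))"

lemma desc_sum_eq_sum_hd:
  assumes "finite A" "A \<noteq> {}"
  shows "desc_sum lam N A = (\<Sum>x\<in>A. desc_sum_hd lam N A x)"
proof -
  have "desc_sum lam N A = (\<Sum>x\<in>A. \<Sum>xs\<in>(#) x ` permutations_of_set (A - {x}). desc_weight lam N xs)"
    unfolding desc_sum_def using assms
    by (subst permutations_of_set_nonempty[OF assms(2)], subst sum.UNION_disjoint) auto
  also have "\<dots> = (\<Sum>x\<in>A. desc_sum_hd lam N A x)"
    by (intro sum.cong refl) (simp add: desc_sum_hd_def sum.reindex)
  finally show ?thesis .
qed

lemma desc_sum_hd_rec:
  assumes "finite A" "x \<in> A" "A - {x} \<noteq> {}"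
  shows "desc_sum_hd lam N A x =
    (\<Sum>y\<in>A - {x}. (of_bool (lam y < lam x) - of_bool (A - {x} \<in> N)) * desc_sum_hd lam N (A - {x}) y)"
proof -
  have *: "desc_weight lam N (x # y # r) =
     (of_bool (lam y < lam x) - of_bool (A - {x} \<in> N)) * desc_weight lam N (y # r)"
    if "y \<in> A - {x}" "r \<in> permutations_of_set (A - {x} - {y})" for y r
  proof -
    have "set (y # r) = A - {x}" using that permutations_of_setD(1)[OF that(2)] by auto
    then show ?thesis by simp
  qed
  have "desc_sum_hd lam N A x = (\<Sum>y\<in>A - {x}. \<Sum>xs\<in>(#) y ` permutations_of_set (A - {x} - {y}).
     desc_weight lam N (x # xs))"
    unfolding desc_sum_hd_def using assms
    by (subst permutations_of_set_nonempty[OF assms(3)], subst sum.UNION_disjoint) auto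
  also have "\<dots> = (\<Sum>y\<in>A - {x}. \<Sum>r\<in>permutations_of_set (A - {x} - {y}). desc_weight lam N (x # y # r))"
    by (simp add: sum.reindex)
  also have "\<dots> = (\<Sum>y\<in>A - {x}. (of_bool (lam y < lam x) - of_bool (A - {x} \<in> N)) * desc_sum_hd lam N (A - {x}) y)"
    unfolding desc_sum_hd_def sum_distrib_left by (intro sum.cong refl *)
  finally show ?thesis .
qed

text \<open>The contribution of the lists whose first selected membership term is at the suffix
  \<open>S\<close>, whose entries may then come in any order. The empty set stands for never
  selecting one: only the decreasing list survives, with weight 1.\<close>

definition cut_term :: "('a \<Rightarrow> real) \<Rightarrow> 'a set set \<Rightarrow> 'a set \<Rightarrow> real" where
  "cut_term lam N S = (if S = {} then 1 else - of_bool (S \<in> N) * desc_sum lam N S)"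

lemma ex_max_on:
  fixes lam :: "'a \<Rightarrow> real"
  assumes "finite U" "U \<noteq> {}"
  shows "\<exists>m\<in>U. \<forall>u\<in>U. lam u \<le> lam m"
proof -
  have "Max (lam ` U) \<in> lam ` U" using assms by simp
  then obtain m where m: "m \<in> U" "Max (lam ` U) = lam m" by auto
  then show ?thesis using assms by (metis Max_ge finite_imageI imageI)
qed

text \<open>Expand the product: if \<open>S\<close> is the suffix at which the membership term is first selected, then
  only descents are selected before it, so the entries before \<open>S\<close> are those of \<open>A - S\<close> in decreasing order.\<close>

lemma desc_sum_hd_eq:
  assumes "finite A" "x \<in> A" "inj_on lam A"
  shows "desc_sum_hd lam N A x =
    (\<Sum>S | S \<subseteq> A - {x} \<and> (\<forall>u\<in>A - S. lam u \<le> lam x). cut_term lam N S)"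
  using assms
proof (induction "card A" arbitrary: A x rule: less_induct)
  case less
  note A = less.prems(1) and x = less.prems(2) and inj = less.prems(3)
  let ?B = "A - {x}"
  have finB: "finite ?B" using A by simp
  show ?case
  proof (cases "?B = {}")
    case True
    then have "A = {x}" using x by auto
    then have *: "{S. S \<subseteq> ?B \<and> (\<forall>u\<in>A - S. lam u \<le> lam x)} = {{}}" by auto
    show ?thesis by (subst *, unfold desc_sum_hd_def True) (simp add: cut_term_def)
  next
    case False
    let ?Q = "\<lambda>y. {S. S \<subseteq> ?B - {y} \<and> (\<forall>u\<in>?B - S. lam u \<le> lam y)}"
    have IH: "desc_sum_hd lam N ?B y = (\<Sum>S\<in>?Q y. cut_term lam N S)" if "y \<in> ?B" for y
      using that A card_Diff1_less[OF A x] inj_on_subset[OF inj, of ?B]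
      by (intro less.hyps) auto
    have "desc_sum_hd lam N A x =
      (\<Sum>y\<in>?B. of_bool (lam y < lam x) * desc_sum_hd lam N ?B y) -
      (\<Sum>y\<in>?B. of_bool (?B \<in> N) * desc_sum_hd lam N ?B y)"
      by (simp add: desc_sum_hd_rec[OF A x False] left_diff_distrib sum_subtractf)
    \<comment> \<open>Selecting the membership term directly after \<open>x\<close> leaves the order
      of the rest free: this is the summand \<open>S = A - {x}\<close>.\<close>
    also have "(\<Sum>y\<in>?B. of_bool (?B \<in> N) * desc_sum_hd lam N ?B y) = - cut_term lam N ?B"
      using False by (simp add: cut_term_def desc_sum_eq_sum_hd[OF finB False] sum_distrib_left sum_negf)
    also have "(\<Sum>y\<in>?B. of_bool (lam y < lam x) * desc_sum_hd lam N ?B y) =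
       (\<Sum>y\<in>{y \<in> ?B. lam y < lam x}. \<Sum>S\<in>?Q y. cut_term lam N S)"
      using finB by (intro sum.mono_neutral_cong_right) (auto simp: IH)
    also have "\<dots> = (\<Sum>S\<in>(\<Union>y\<in>{y \<in> ?B. lam y < lam x}. ?Q y). cut_term lam N S)"
    proof (rule sum.UNION_disjoint[symmetric])
      show "\<forall>y\<in>{y \<in> ?B. lam y < lam x}. \<forall>y'\<in>{y \<in> ?B. lam y < lam x}. y \<noteq> y' \<longrightarrow> ?Q y \<inter> ?Q y' = {}"
      proof (intro ballI impI)
        fix y y' assume y: "y \<in> {y \<in> ?B. lam y < lam x}" "y' \<in> {y \<in> ?B. lam y < lam x}" "y \<noteq> y'"
        show "?Q y \<inter> ?Q y' = {}"
        proof (rule ccontr)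
          assume "?Q y \<inter> ?Q y' \<noteq> {}"
          then obtain S where S: "S \<in> ?Q y" "S \<in> ?Q y'" by blast
          then have "lam y = lam y'" using y by (intro antisym) auto
          then show False using y inj by (auto dest: inj_onD)
        qed
      qed
    qed (use finB in auto)
    \<comment> \<open>Every other \<open>S\<close> arises from exactly one second entry
      \<open>y\<close>, the point of \<open>?B - S\<close> where \<open>lam\<close> is
      largest.\<close>
    also have "(\<Union>y\<in>{y \<in> ?B. lam y < lam x}. ?Q y) =
        {S. S \<subseteq> ?B \<and> (\<forall>u\<in>A - S. lam u \<le> lam x)} - {?B}" (is "?L = ?R")
    proof (intro equalityI subsetI)
      fix S assume "S \<in> ?L"
      then obtain y where y: "y \<in> ?B" "lam y < lam x" "S \<subseteq> ?B - {y}" "\<forall>u\<in>?B - S. lam u \<le> lam y"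
        by auto
      then have "lam u \<le> lam x" if "u \<in> A - S" for u
        using that by (cases "u = x") force+
      then show "S \<in> ?R" using y by auto
    next
      fix S assume S: "S \<in> ?R"
      then have "?B - S \<noteq> {}" by auto
      then obtain y where y: "y \<in> ?B - S" "\<forall>u\<in>?B - S. lam u \<le> lam y"
        using ex_max_on[of "?B - S" lam] finB by auto
      have "lam y \<le> lam x" using y S by auto
      moreover have "lam y \<noteq> lam x" using y inj x by (auto dest: inj_onD)
      ultimately have "lam y < lam x" by simp
      then show "S \<in> ?L" using y S by auto
    qed
    also have "sum (cut_term lam N) \<dots> - - cut_term lam N ?B =
        (\<Sum>S | S \<subseteq> ?B \<and> (\<forall>u\<in>A - S. lam u \<le> lam x). cut_term lam N S)"
    proof -
      have "?B \<in> {S. S \<subseteq> ?B \<and> (\<forall>u\<in>A - S. lam u \<le> lam x)}" using x by auto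
      moreover have "finite {S. S \<subseteq> ?B \<and> (\<forall>u\<in>A - S. lam u \<le> lam x)}" using finB by auto
      ultimately have "(\<Sum>S | S \<subseteq> ?B \<and> (\<forall>u\<in>A - S. lam u \<le> lam x). cut_term lam N S) = cut_term lam N ?B +
          sum (cut_term lam N) ({S. S \<subseteq> ?B \<and> (\<forall>u\<in>A - S. lam u \<le> lam x)} - {?B})"
        by (intro sum.remove)
      then show ?thesis by linarith
    qed
    finally show ?thesis .
  qed
qed

text \<open>Each proper subset \<open>S\<close> of \<open>A\<close> occurs for exactly one head, the
  maximiser of \<open>lam\<close> on \<open>A - S\<close>. Unrolled, the recursion gives the sum of
  (-1)^k over all chains of \<open>k\<close> nonempty members of \<open>N\<close> properly inside
  \<open>A\<close>, which is minus the reduced Euler characteristic of their order complex; in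
  particular the value does not depend on \<open>lam\<close>.\<close>

lemma desc_sum_rec:
  assumes A: "finite A" "A \<noteq> {}" and inj: "inj_on lam A"
  shows "desc_sum lam N A = 1 - (\<Sum>S | S \<in> N \<and> S \<subset> A \<and> S \<noteq> {}. desc_sum lam N S)"
proof -
  let ?Q = "\<lambda>x. {S. S \<subseteq> A - {x} \<and> (\<forall>u\<in>A - S. lam u \<le> lam x)}"
  have "desc_sum lam N A = (\<Sum>x\<in>A. \<Sum>S\<in>?Q x. cut_term lam N S)"
    using A inj by (simp add: desc_sum_eq_sum_hd desc_sum_hd_eq)
  also have "\<dots> = (\<Sum>S\<in>(\<Union>x\<in>A. ?Q x). cut_term lam N S)"
  proof (rule sum.UNION_disjoint[symmetric])
    show "\<forall>y\<in>A. \<forall>y'\<in>A. y \<noteq> y' \<longrightarrow> ?Q y \<inter> ?Q y' = {}"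
    proof (intro ballI impI)
      fix y y' assume y: "y \<in> A" "y' \<in> A" "y \<noteq> y'"
      show "?Q y \<inter> ?Q y' = {}"
      proof (rule ccontr)
        assume "?Q y \<inter> ?Q y' \<noteq> {}"
        then obtain S where S: "S \<in> ?Q y" "S \<in> ?Q y'" by blast
        then have "lam y = lam y'" using y by (intro antisym) auto
        then show False using y inj by (auto dest: inj_onD)
      qed
    qed
  qed (use A in auto)
  also have "(\<Union>x\<in>A. ?Q x) = {S. S \<subset> A}" (is "?L = ?R")
  proof (intro equalityI subsetI)
    fix S assume S: "S \<in> ?R"
    then have "A - S \<noteq> {}" by auto
    then obtain y where y: "y \<in> A - S" "\<forall>u\<in>A - S. lam u \<le> lam y"
      using ex_max_on[of "A - S" lam] A by auto
    then show "S \<in> ?L" using S by auto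
  qed auto
  finally have eq: "desc_sum lam N A = (\<Sum>S | S \<subset> A. cut_term lam N S)" .
  have finS: "finite {S. S \<subset> A}" by (rule finite_subset[of _ "Pow A"]) (use A in auto)
  note eq
  also have "(\<Sum>S\<in>{S. S \<subset> A}. cut_term lam N S) =
      cut_term lam N {} + (\<Sum>S\<in>{S. S \<subset> A} - {{}}. cut_term lam N S)"
    using A finS by (intro sum.remove) auto
  also have "(\<Sum>S\<in>{S. S \<subset> A} - {{}}. cut_term lam N S) =
      (\<Sum>S | S \<in> N \<and> S \<subset> A \<and> S \<noteq> {}. - desc_sum lam N S)"
    using finS by (intro sum.mono_neutral_cong_right) (auto simp: cut_term_def)
  finally show ?thesis by (simp add: cut_term_def sum_negf)
qed

lemma desc_sum_empty_family:
  assumes "finite G" "G \<noteq> {}" "inj_on lam G" "N \<inter> Pow G = {}"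
  shows "desc_sum lam N G = 1"
proof -
  have "{S. S \<in> N \<and> S \<subset> G \<and> S \<noteq> {}} = {}" using assms by auto
  then show ?thesis unfolding desc_sum_rec[OF assms(1-3)] by (simp only: sum.empty diff_zero)
qed

text \<open>The joining map \<open>A \<mapsto> A \<union> B\<close> is a closure operator on \<open>N\<close> whose image has the least element
  \<open>B\<close>, so the order complex of \<open>N\<close> is contractible and its reduced Euler characteristic vanishes.\<close>

lemma desc_sum_conical_family:
  assumes G: "finite G" and inj: "inj_on lam G"
    and N: "N \<subseteq> Pow G" "{} \<notin> N" "G \<notin> N"
    and B: "B \<in> N" and cl: "\<And>A. A \<in> N \<Longrightarrow> A \<union> B \<in> N"
  shows "desc_sum lam N G = 0"
proof -
  have finN: "finite N" using N G by (meson finite_Pow_iff finite_subset)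
  let ?K = "desc_sum lam N"
  \<comment> \<open>For \<open>T\<close> in \<open>N\<close> the recursion says that the weights of
    all members of \<open>N\<close> below \<open>T\<close>, with \<open>T\<close> included, add up
    to 1.\<close>
  have one: "(\<Sum>S | S \<in> N \<and> S \<subseteq> T. ?K S) = 1" if "T \<in> N" for T
  proof -
    have T: "finite T" "T \<noteq> {}" "inj_on lam T" "T \<subseteq> G"
      using that N G inj by (auto intro: finite_subset inj_on_subset)
    have "{S. S \<in> N \<and> S \<subseteq> T} = insert T {S. S \<in> N \<and> S \<subset> T \<and> S \<noteq> {}}"
      using that N by auto
    then show ?thesis using desc_sum_rec[OF T(1-3), of N] finN by simp
  qed
  \<comment> \<open>The total weight of the fibre over \<open>T\<close> of the map joining
    \<open>B\<close>.\<close>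
  define W where "W T = (\<Sum>S | S \<in> N \<and> S \<union> B = T. ?K S)" for T
  have fib: "(\<Sum>S | S \<in> N \<and> S \<subseteq> T. ?K S) = (\<Sum>T' | T' \<in> N \<and> B \<subseteq> T' \<and> T' \<subseteq> T. W T')"
    if "B \<subseteq> T" for T
  proof -
    have "(\<Sum>T' | T' \<in> N \<and> B \<subseteq> T' \<and> T' \<subseteq> T. W T') =
       (\<Sum>T' | T' \<in> N \<and> B \<subseteq> T' \<and> T' \<subseteq> T. \<Sum>S | S \<in> {S. S \<in> N \<and> S \<subseteq> T} \<and> S \<union> B = T'. ?K S)"
      unfolding W_def by (intro sum.cong) auto
    also have "\<dots> = (\<Sum>S | S \<in> N \<and> S \<subseteq> T. ?K S)"
      using finN that cl by (intro sum.group) auto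
    finally show ?thesis ..
  qed
  \<comment> \<open>By \<open>one\<close>, the fibre weights between \<open>B\<close> and
    \<open>T\<close> sum to 1 for every \<open>T\<close>; by induction they are concentrated at the
    least element \<open>B\<close>.\<close>
  have W0: "W T = of_bool (T = B)" if "T \<in> N" "B \<subseteq> T" for T
    using that
  proof (induction "card T" arbitrary: T rule: less_induct)
    case less
    have finT: "finite T" using less.prems N G by (auto intro: finite_subset)
    have "1 = (\<Sum>T' | T' \<in> N \<and> B \<subseteq> T' \<and> T' \<subseteq> T. W T')"
      unfolding fib[OF less.prems(2), symmetric] by (rule one[OF less.prems(1), symmetric])
    also have "\<dots> = W T + (\<Sum>T' | T' \<in> N \<and> B \<subseteq> T' \<and> T' \<subset> T. W T')"
    proof -
      have "{T'. T' \<in> N \<and> B \<subseteq> T' \<and> T' \<subseteq> T} = insert T {T'. T' \<in> N \<and> B \<subseteq> T' \<and> T' \<subset> T}"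
        using less.prems by auto
      then show ?thesis using finN by simp
    qed
    also have "(\<Sum>T' | T' \<in> N \<and> B \<subseteq> T' \<and> T' \<subset> T. W T') =
        (\<Sum>T' | T' \<in> N \<and> B \<subseteq> T' \<and> T' \<subset> T. of_bool (T' = B))"
      using finT by (intro sum.cong refl less.hyps) (auto intro: psubset_card_mono)
    also have "\<dots> = (\<Sum>T' | T' \<in> N \<and> B \<subseteq> T' \<and> T' \<subset> T. if T' = B then 1 else 0)"
      by (intro sum.cong) auto
    also have "\<dots> = of_bool (B \<subset> T)" using finN B by (subst sum.delta) auto
    finally show ?case using less.prems by (cases "T = B") (auto simp: psubset_eq)
  qed
  have BG: "B \<subseteq> G" using B N by auto
  \<comment> \<open>Hence the weights on all of \<open>N\<close> sum to 1 as well, although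
    \<open>G\<close> is not in \<open>N\<close>, and the recursion at \<open>G\<close> leaves 1 -
    1.\<close>
  have "(\<Sum>S | S \<in> N \<and> S \<subset> G \<and> S \<noteq> {}. ?K S) = (\<Sum>S | S \<in> N \<and> S \<subseteq> G. ?K S)"
    using N by (intro sum.cong) auto
  also have "\<dots> = (\<Sum>T' | T' \<in> N \<and> B \<subseteq> T' \<and> T' \<subseteq> G. of_bool (T' = B))"
    unfolding fib[OF BG] by (intro sum.cong) (auto simp: W0)
  also have "\<dots> = (\<Sum>T' | T' \<in> N \<and> B \<subseteq> T' \<and> T' \<subseteq> G. if T' = B then 1 else 0)"
    by (intro sum.cong) auto
  also have "\<dots> = 1" using finN B BG by (subst sum.delta) auto
  finally show ?thesis using desc_sum_rec[OF G _ inj, of N] B N by fastforce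
qed

section \<open>Slack coordinates along a chain\<close>

abbreviation lborel_Pi :: "nat set \<Rightarrow> (nat \<Rightarrow> real) measure" where
  "lborel_Pi I \<equiv> Pi\<^sub>M I (\<lambda>_. lborel)"

text \<open>Since \<open>g\<close> ignores coordinate \<open>k\<close>, fixing the other coordinates
  leaves the reflection of a line, which preserves Lebesgue measure; Fubini does the rest.\<close>

lemma distr_shear_lborel_Pi:
  fixes g :: "(nat \<Rightarrow> real) \<Rightarrow> real"
  assumes I: "finite I" "k \<in> I"
    and g[measurable]: "g \<in> borel_measurable (lborel_Pi I)"
    and gk: "\<And>x a. g (x(k := a)) = g x"
  shows "(\<lambda>x. x(k := g x - x k)) \<in> lborel_Pi I \<rightarrow>\<^sub>M lborel_Pi I"
    and "distr (lborel_Pi I) (lborel_Pi I) (\<lambda>x. x(k := g x - x k)) = lborel_Pi I"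
proof -
  define J where "J = I - {k}"
  have IJ: "I = insert k J" "finite J" "k \<notin> J" using I by (auto simp: J_def)
  interpret product_sigma_finite "\<lambda>_::nat. lborel :: real measure"
    by standard
  let ?f = "\<lambda>x. x(k := g x - x k)"
  have gm: "(\<lambda>x. g x - x k) \<in> borel_measurable (lborel_Pi I)"
    using I(2) by measurable
  have upd: "(\<lambda>x. x(k := h x)) \<in> lborel_Pi I \<rightarrow>\<^sub>M lborel_Pi I"
    if "h \<in> borel_measurable (lborel_Pi I)" for h
  proof (rule measurable_PiM_single')
    fix i assume "i \<in> I"
    then show "(\<lambda>x. (x(k := h x)) i) \<in> lborel_Pi I \<rightarrow>\<^sub>M lborel"
      using that by (cases "i = k") (auto intro: measurable_component_singleton)
  qed (use I in \<open>auto simp: space_PiM PiE_def extensional_def\<close>)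
  show meas: "?f \<in> lborel_Pi I \<rightarrow>\<^sub>M lborel_Pi I" by (rule upd[OF gm])
  show "distr (lborel_Pi I) (lborel_Pi I) ?f = lborel_Pi I"
  proof (rule measure_eqI)
    fix A assume "A \<in> sets (distr (lborel_Pi I) (lborel_Pi I) ?f)"
    then have A[measurable]: "A \<in> sets (lborel_Pi I)" by simp
    have Aj: "A \<in> sets (lborel_Pi (insert k J))" using A IJ by simp
    have "emeasure (distr (lborel_Pi I) (lborel_Pi I) ?f) A
        = emeasure (lborel_Pi I) (?f -` A \<inter> space (lborel_Pi I))"
      using meas A by (rule emeasure_distr)
    also have "\<dots> = (\<integral>\<^sup>+x. indicator (?f -` A \<inter> space (lborel_Pi I)) x \<partial>lborel_Pi I)"
      using meas A by (intro nn_integral_indicator[symmetric]) (auto intro: measurable_sets)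
    also have "\<dots> = (\<integral>\<^sup>+x. indicator A (?f x) \<partial>lborel_Pi I)"
      by (intro nn_integral_cong) (auto simp: indicator_def)
    also have "\<dots> = (\<integral>\<^sup>+x. (\<integral>\<^sup>+v. indicator A (?f (x(k := v))) \<partial>lborel) \<partial>lborel_Pi J)"
    proof -
      have "(\<lambda>x. indicator A (?f x) :: ennreal) \<in> borel_measurable (lborel_Pi (insert k J))"
        unfolding IJ(1)[symmetric] by (rule measurable_compose[OF meas borel_measurable_indicator[OF A]])
      from product_nn_integral_insert[OF IJ(2,3) this] show ?thesis unfolding IJ(1) .
    qed
    also have "\<dots> = (\<integral>\<^sup>+x. (\<integral>\<^sup>+v. indicator A (x(k := v)) \<partial>lborel) \<partial>lborel_Pi J)"
    proof (rule nn_integral_cong)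
      fix x assume x: "x \<in> space (lborel_Pi J)"
      have "(\<lambda>v. x(k := v)) \<in> borel \<rightarrow>\<^sub>M lborel_Pi (insert k J)"
        by (rule measurable_fun_upd[where J = J]) (use x in auto)
      then have m: "(\<lambda>v. indicator A (x(k := v)) :: ennreal) \<in> borel_measurable borel"
        by (rule measurable_compose[OF _ borel_measurable_indicator[OF Aj]])
      have "(\<integral>\<^sup>+v. indicator A (x(k := v)) \<partial>lborel)
          = ennreal \<bar>-1\<bar> * (\<integral>\<^sup>+v. indicator A (x(k := g x + (-1) * v)) \<partial>lborel)"
        by (rule nn_integral_real_affine[OF m]) simp
      then show "(\<integral>\<^sup>+v. indicator A (?f (x(k := v))) \<partial>lborel)
          = (\<integral>\<^sup>+v. indicator A (x(k := v)) \<partial>lborel)"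
        by (simp add: gk)
    qed
    also have "\<dots> = (\<integral>\<^sup>+x. indicator A x \<partial>lborel_Pi I)"
      unfolding IJ(1)
      by (rule product_nn_integral_insert[OF IJ(2,3) borel_measurable_indicator[OF Aj], symmetric])
    also have "\<dots> = emeasure (lborel_Pi I) A" using A by simp
    finally show "emeasure (distr (lborel_Pi I) (lborel_Pi I) ?f) A = emeasure (lborel_Pi I) A" .
  qed simp
qed

lemma distr_shear_comp:
  fixes g :: "(nat \<Rightarrow> real) \<Rightarrow> real"
  assumes "finite I" "k \<in> I" "g \<in> borel_measurable (lborel_Pi I)" "\<And>x a. g (x(k := a)) = g x"
    and F: "F \<in> lborel_Pi I \<rightarrow>\<^sub>M lborel_Pi I \<and> distr (lborel_Pi I) (lborel_Pi I) F = lborel_Pi I"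
    and H: "\<And>x. x \<in> space (lborel_Pi I) \<Longrightarrow> H x = (F x)(k := g (F x) - F x k)"
  shows "H \<in> lborel_Pi I \<rightarrow>\<^sub>M lborel_Pi I \<and> distr (lborel_Pi I) (lborel_Pi I) H = lborel_Pi I"
proof -
  let ?s = "\<lambda>x. x(k := g x - x k)"
  note s = distr_shear_lborel_Pi[OF assms(1-4)]
  have m: "?s \<circ> F \<in> lborel_Pi I \<rightarrow>\<^sub>M lborel_Pi I" using F s(1) by (auto intro: measurable_comp)
  have "distr (lborel_Pi I) (lborel_Pi I) H = distr (lborel_Pi I) (lborel_Pi I) (?s \<circ> F)"
    using H by (intro distr_cong) auto
  also have "\<dots> = distr (distr (lborel_Pi I) (lborel_Pi I) F) (lborel_Pi I) ?s"
    using F s(1) by (intro distr_distr[symmetric]) auto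
  also have "\<dots> = lborel_Pi I" using F s(2) by simp
  finally have "distr (lborel_Pi I) (lborel_Pi I) H = lborel_Pi I" .
  moreover have "H \<in> lborel_Pi I \<rightarrow>\<^sub>M lborel_Pi I \<longleftrightarrow> ?s \<circ> F \<in> lborel_Pi I \<rightarrow>\<^sub>M lborel_Pi I"
    using H by (intro measurable_cong) auto
  ultimately show ?thesis using m by simp
qed

text \<open>Restores the \<open>n\<close>-th coordinate of a point of the hyperplane with coordinate sum \<open>c\<close>.\<close>

definition lift_last :: "nat \<Rightarrow> real \<Rightarrow> (nat \<Rightarrow> real) \<Rightarrow> nat \<Rightarrow> real" where
  "lift_last n c x j = (if j = n then c - (\<Sum>i\<in>{1..<n}. x i) else x j)"

lemma sum_lift_last: "n \<ge> 1 \<Longrightarrow> (\<Sum>j\<in>{1..n}. lift_last n c x j) = c"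
proof -
  assume "n \<ge> 1"
  then have "{1..n} = insert n {1..<n}" by auto
  then show ?thesis by (simp add: lift_last_def)
qed

definition chain_coords ::
    "nat \<Rightarrow> real \<Rightarrow> (nat \<Rightarrow> real) \<Rightarrow> (nat \<Rightarrow> nat) \<Rightarrow> (nat \<Rightarrow> real) \<Rightarrow> nat \<Rightarrow> real" where
  "chain_coords n c q w x = (\<lambda>i\<in>{1..<n}. q i - (\<Sum>m\<in>{1..i}. lift_last n c x (w m)))"

lemma chain_coords_id:
  assumes "n \<ge> 1"
  shows "chain_coords n c q id \<in> lborel_Pi {1..<n} \<rightarrow>\<^sub>M lborel_Pi {1..<n} \<and>
    distr (lborel_Pi {1..<n}) (lborel_Pi {1..<n}) (chain_coords n c q id) = lborel_Pi {1..<n}"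
proof -
  let ?M = "lborel_Pi {1..<n}"
  \<comment> \<open>Only the coordinates from \<open>m\<close> on are replaced. Going down from
    \<open>F n\<close>, the identity, to \<open>F 1\<close>, the coordinates below \<open>k\<close>
    are still the original ones when coordinate \<open>k\<close> is replaced, so each step is a
    single shear.\<close>
  define F where "F m x = (\<lambda>i\<in>{1..<n}. if m \<le> i then q i - (\<Sum>j\<in>{1..i}. x j) else x i)"
    for m and x :: "nat \<Rightarrow> real"
  have F: "F m \<in> ?M \<rightarrow>\<^sub>M ?M \<and> distr ?M ?M (F m) = ?M" if "1 \<le> m" "m \<le> n" for m
    using that(2,1)
  proof (induction rule: inc_induct)
    case base
    have id: "F n x = x" if "x \<in> space ?M" for x
      using that by (auto simp: F_def space_PiM PiE_def extensional_def restrict_def)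
    then have "F n \<in> ?M \<rightarrow>\<^sub>M ?M \<longleftrightarrow> (\<lambda>x. x) \<in> ?M \<rightarrow>\<^sub>M ?M" by (intro measurable_cong) auto
    moreover have "distr ?M ?M (F n) = distr ?M ?M (\<lambda>x. x)" using id by (intro distr_cong) auto
    ultimately show ?case by simp
  next
    case (step k)
    show ?case
    proof (rule distr_shear_comp[where k = k and F = "F (Suc k)" and
          g = "\<lambda>s. q k - (\<Sum>j\<in>{1..<k}. s j)"])
      show "k \<in> {1..<n}" using step by simp
      show "F (Suc k) \<in> ?M \<rightarrow>\<^sub>M ?M \<and> distr ?M ?M (F (Suc k)) = ?M"
        using step.IH by simp
      show "(\<lambda>s. q k - (\<Sum>j\<in>{1..<k}. s j)) \<in> borel_measurable ?M"
        using step by (intro borel_measurable_diff borel_measurable_sum borel_measurable_const)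
          (auto intro!: measurable_component_singleton[where M = "\<lambda>_. lborel", simplified])
      fix x assume "x \<in> space ?M"
      have "{1..k} = insert k {1..<k}" using step by auto
      moreover have "(\<Sum>j\<in>{1..<k}. F (Suc k) x j) = (\<Sum>j\<in>{1..<k}. x j)"
        using step by (intro sum.cong) (auto simp: F_def)
      ultimately show "F k x = (F (Suc k) x)
          (k := (q k - (\<Sum>j\<in>{1..<k}. F (Suc k) x j)) - F (Suc k) x k)"
        using step by (auto simp: F_def fun_eq_iff)
    qed auto
  qed
  have "chain_coords n c q id = F 1"
    by (intro ext) (auto simp: chain_coords_def F_def lift_last_def restrict_def intro!: sum.cong)
  then show ?thesis using F[of 1] assms by simp
qed

lemma permutes_eq_id_if_no_descent:
  assumes w: "w permutes {1..n::nat}" and asc: "\<And>k. 1 \<le> k \<Longrightarrow> k < n \<Longrightarrow> w k \<le> w (k + 1)"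
  shows "w = id"
proof (rule permutes_natset_ge[OF w])
  have "i \<le> w i" if "1 \<le> i" "i \<le> n" for i
    using that
  proof (induction i rule: nat_induct_at_least)
    case base
    then show ?case using permutes_in_image[OF w, of 1] by auto
  next
    case (Suc i)
    have "w i \<noteq> w (i + 1)" using permutes_inj[OF w] by (metis add_cancel_right_right injD one_neq_zero)
    then show ?case using Suc asc[of i] by auto
  qed
  then show "\<forall>i\<in>{1..n}. i \<le> w i" by auto
qed

text \<open>Exchanging \<open>w k\<close> and \<open>w (k + 1)\<close> alters only the \<open>k\<close>-th partial sum \<open>T k\<close>, which becomes
  \<open>T (k - 1) + T (k + 1) - T k\<close>: a measure preserving shear composed with a reflection.\<close>

lemma chain_coords_swap:
  assumes w: "w permutes {1..n}" and k: "1 \<le> k" "k < n"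
    and IH: "chain_coords n c q w \<in> lborel_Pi {1..<n} \<rightarrow>\<^sub>M lborel_Pi {1..<n} \<and>
      distr (lborel_Pi {1..<n}) (lborel_Pi {1..<n}) (chain_coords n c q w) = lborel_Pi {1..<n}"
    and v: "v = w \<circ> Transposition.transpose k (k + 1)"
  shows "chain_coords n c q v \<in> lborel_Pi {1..<n} \<rightarrow>\<^sub>M lborel_Pi {1..<n} \<and>
      distr (lborel_Pi {1..<n}) (lborel_Pi {1..<n}) (chain_coords n c q v) = lborel_Pi {1..<n}"
proof -
  let ?M = "lborel_Pi {1..<n}"
  \<comment> \<open>In the old slacks, \<open>s i - q i\<close> is minus the \<open>i\<close>-th
    partial sum. The sums at 0 and \<open>n\<close> are not coordinates; they are the constants 0
    and \<open>c\<close>. One \<open>q k\<close> is the new offset, the other cancels the one in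
    \<open>s k\<close>.\<close>
  define g where "g s = q k + (if k = 1 then 0 else s (k - 1) - q (k - 1))
     + (if k + 1 = n then - c else s (k + 1) - q (k + 1)) + q k" for s :: "nat \<Rightarrow> real"
  have comp: "(\<lambda>s. s i) \<in> borel_measurable ?M" if "i \<in> {1..<n}" for i
    using measurable_component_singleton[OF that, of "\<lambda>_. lborel"] by simp
  have c1: "(\<lambda>s. if k = 1 then 0 else s (k - 1) - q (k - 1)) \<in> borel_measurable ?M"
  proof (cases "k = 1")
    case False
    then have "k - 1 \<in> {1..<n}" using k by auto
    from borel_measurable_diff[OF comp[OF this] borel_measurable_const] show ?thesis
      by (simp only: False if_False)
  qed simp
  have c2: "(\<lambda>s. if k + 1 = n then - c else s (k + 1) - q (k + 1)) \<in> borel_measurable ?M"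
  proof (cases "k + 1 = n")
    case False
    then have "k + 1 \<in> {1..<n}" using k by auto
    from borel_measurable_diff[OF comp[OF this] borel_measurable_const] show ?thesis
      by (simp only: False if_False)
  qed simp
  show ?thesis
  proof (rule distr_shear_comp[where k = k and g = g, OF _ _ _ _ IH])
    show "g \<in> borel_measurable ?M"
      unfolding g_def by (intro borel_measurable_add borel_measurable_const c1 c2)
    show "g (x(k := a)) = g x" for x a
    proof -
      have "k - 1 \<noteq> k" using k by simp
      then show ?thesis by (simp add: g_def)
    qed
    fix x assume "x \<in> space ?M"
    define T where "T u i = (\<Sum>m\<in>{1..i}. lift_last n c x (u m))" for u :: "nat \<Rightarrow> nat" and i
    have Tn: "T w n = c"
    proof -
      have "T w n = (\<Sum>j\<in>{1..n}. lift_last n c x j)"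
        unfolding T_def by (rule sum.permute[OF w, symmetric, unfolded o_def])
      then show ?thesis using sum_lift_last k by simp
    qed
    have TS: "T u (Suc i) = T u i + lift_last n c x (u (Suc i))" for u i by (simp add: T_def)
    have T1: "T v i = T w i" if "i < k" for i
      unfolding T_def v using that by (intro sum.cong) (auto simp: Transposition.transpose_def)
    have k': "Suc (k - 1) = k" using k by simp
    have vk: "v k = w (k + 1)" "v (k + 1) = w k" by (simp_all add: v Transposition.transpose_def)
    have Tk: "T v k = T w (k - 1) + T w (k + 1) - T w k"
      using TS[of v "k - 1"] TS[of w "k - 1"] TS[of w k] T1[of "k - 1"] k vk unfolding k' by simp
    have T2: "T v i = T w i" if "k < i" for i
    proof -
      have "Transposition.transpose k (k + 1) permutes {1..i}" using that k by (intro permutes_swap_id) auto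
      from sum.permute[OF this, of "\<lambda>m. lift_last n c x (w m)"] show ?thesis
        unfolding T_def v by (simp add: o_def)
    qed
    have cc: "chain_coords n c q u x i = (if i \<in> {1..<n} then q i - T u i else undefined)" for u i
      by (auto simp: chain_coords_def T_def)
    define s where "s = chain_coords n c q w x"
    have s: "s i = q i - T w i" if "1 \<le> i" "i < n" for i
      using that by (simp add: s_def cc)
    have "g s - s k = q k - T v k"
    proof -
      have "(if k = 1 then 0 else s (k - 1) - q (k - 1)) = - T w (k - 1)"
        using k by (auto simp: s T_def)
      moreover have "(if k + 1 = n then - c else s (k + 1) - q (k + 1)) = - T w (k + 1)"
        using k Tn by (auto simp: s)
      ultimately show ?thesis unfolding g_def using s[OF k] Tk by linarith
    qed
    moreover have "T v i = T w i" if "i \<noteq> k" for i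
      using that T1 T2 by (metis linorder_neqE_nat)
    ultimately have "chain_coords n c q v x i = (s(k := g s - s k)) i" for i
      using s k by (cases "i \<in> {1..<n}"; cases "i = k") (auto simp: cc s_def)
    then show "chain_coords n c q v x = (chain_coords n c q w x)
        (k := g (chain_coords n c q w x) - chain_coords n c q w x k)"
      by (simp add: fun_eq_iff s_def)
  qed (use k in auto)
qed

text \<open>Bubble sort: removing descents by adjacent exchanges leads from \<open>w\<close> to the
  identity.\<close>

lemma chain_coords_measure_preserving:
  assumes "n \<ge> 1" and w: "w permutes {1..n}"
  shows "chain_coords n c q w \<in> lborel_Pi {1..<n} \<rightarrow>\<^sub>M lborel_Pi {1..<n} \<and>
      distr (lborel_Pi {1..<n}) (lborel_Pi {1..<n}) (chain_coords n c q w) = lborel_Pi {1..<n}"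
  using w
\<comment> \<open>Removing a descent raises the sum of \<open>i * w i\<close>; passing to
  \<open>n - w i\<close> gives a decreasing natural number.\<close>
proof (induction "\<Sum>i\<in>{1..n}. i * (n - w i)" arbitrary: w rule: less_induct)
  case less
  show ?case
  proof (cases "\<forall>k. 1 \<le> k \<longrightarrow> k < n \<longrightarrow> w k \<le> w (k + 1)")
    case True
    then have "w = id" using less.prems by (intro permutes_eq_id_if_no_descent) auto
    then show ?thesis using chain_coords_id[OF assms(1)] by simp
  next
    case False
    then obtain k where k: "1 \<le> k" "k < n" "w (k + 1) < w k" by (auto simp: not_le)
    let ?t = "Transposition.transpose k (k + 1)"
    define u where "u = w \<circ> ?t"
    have t: "?t permutes {1..n}" using k by (intro permutes_swap_id) auto
    have u: "u permutes {1..n}" unfolding u_def by (rule permutes_compose[OF t less.prems])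
    have wu: "w = u \<circ> ?t" by (simp add: u_def comp_assoc)
    have split: "{1..n} = insert k (insert (k + 1) ({1..n} - {k, k + 1}))" using k by auto
    have sum_split: "(\<Sum>i\<in>{1..n}. h i) = h k + h (k + 1) + (\<Sum>i\<in>{1..n} - {k, k + 1}. h i)"
      for h :: "nat \<Rightarrow> nat"
      by (subst split) simp
    have uk: "u k = w (k + 1)" "u (k + 1) = w k" by (simp_all add: u_def Transposition.transpose_def)
    have rest: "(\<Sum>i\<in>{1..n} - {k, k + 1}. i * (n - u i)) = (\<Sum>i\<in>{1..n} - {k, k + 1}. i * (n - w i))"
      by (intro sum.cong) (auto simp: u_def Transposition.transpose_def)
    have "w k \<le> n" using permutes_in_image[OF less.prems, of k] k by auto
    then have "n - w k < n - w (k + 1)" using k by linarith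
    moreover have "k * b + (k + 1) * a < k * a + (k + 1) * b" if "a < b" for a b :: nat
      using that by (simp add: algebra_simps)
    ultimately have "k * (n - w (k + 1)) + (k + 1) * (n - w k) < k * (n - w k) + (k + 1) * (n - w (k + 1))"
      by blast
    then have "(\<Sum>i\<in>{1..n}. i * (n - u i)) < (\<Sum>i\<in>{1..n}. i * (n - w i))"
      unfolding sum_split rest uk by linarith
    from less.hyps[OF this u] show ?thesis
      by (rule chain_coords_swap[OF u k(1,2) _ wu])
  qed
qed

section \<open>Volumes of half-open simplices\<close>

text \<open>The facets through the origin are kept or dropped according to the sign of \<open>a i\<close>, so that the cone
  decomposition below holds at every point and not just almost everywhere.\<close>

definition signed_simplex :: "nat set \<Rightarrow> (nat \<Rightarrow> real) \<Rightarrow> real \<Rightarrow> (nat \<Rightarrow> real) set" where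
  "signed_simplex I a r = {s \<in> space (lborel_Pi I).
     (\<forall>i\<in>I. if a i > 0 then s i \<ge> 0 else s i < 0) \<and> (\<Sum>i\<in>I. a i * s i) \<le> r}"

lemma sets_signed_simplex [measurable]:
  assumes "finite I"
  shows "signed_simplex I a r \<in> sets (lborel_Pi I)"
proof -
  have comp: "(\<lambda>s. s i) \<in> borel_measurable (lborel_Pi I)" if "i \<in> I" for i
    using measurable_component_singleton[OF that, of "\<lambda>_. lborel"] by simp
  have "signed_simplex I a r =
     Pi\<^sub>E I (\<lambda>i. if a i > 0 then {0..} else {..<0}) \<inter> {s \<in> space (lborel_Pi I). (\<Sum>i\<in>I. a i * s i) \<le> r}"
    by (auto simp: signed_simplex_def space_PiM PiE_def Pi_def split: if_splits)
  also have "\<dots> \<in> sets (lborel_Pi I)"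
    using assms
    by (intro sets.Int sets_PiM_I_finite borel_measurable_le borel_measurable_sum borel_measurable_const)
      (auto intro: comp)
  finally show ?thesis .
qed

text \<open>Slicing at the value \<open>v\<close> of one coordinate gives a simplex of the same kind
  with bound \<open>r - a b * v\<close>; integrating its volume over \<open>v\<close> raises the
  exponent by one.\<close>

lemma emeasure_signed_simplex:
  assumes "finite I" "\<And>i. i \<in> I \<Longrightarrow> a i \<noteq> 0" "r \<ge> 0"
  shows "emeasure (lborel_Pi I) (signed_simplex I a r) =
    ennreal (r ^ card I / (fact (card I) * (\<Prod>i\<in>I. \<bar>a i\<bar>)))"
  using assms
proof (induction arbitrary: r rule: finite_induct)
  case (empty r)
  then show ?case by (simp add: PiM_empty signed_simplex_def)
next
  case (insert b I r)
  interpret product_sigma_finite "\<lambda>_::nat. lborel :: real measure"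
    by standard
  define m where "m = card I"
  define C where "C = fact m * (\<Prod>i\<in>I. \<bar>a i\<bar>)"
  have C: "C > 0" using insert.prems by (auto simp: C_def intro!: mult_pos_pos prod_pos)
  have b: "a b \<noteq> 0" using insert.prems by auto
  \<comment> \<open>A slice can be nonempty only for \<open>v\<close> in \<open>Y\<close>, because
    every term \<open>a i * s i\<close> is nonnegative. On \<open>Y\<close> the bound
    \<open>r - a b * v\<close> is nonnegative, as the induction hypothesis requires.\<close>
  define Y where "Y = {v. (if a b > 0 then v \<ge> 0 else v < 0) \<and> a b * v \<le> r}"
  have Y_eq: "Y = (if a b > 0 then {0..r / a b} else {r / a b..<0})"
    using b insert.prems(2) by (auto simp: Y_def field_simps)
  have Y_meas[measurable]: "Y \<in> sets borel" by (auto simp: Y_eq)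
  have nn: "0 \<le> (\<Sum>i\<in>I. a i * s i)" if "\<forall>i\<in>I. if a i > 0 then s i \<ge> 0 else s i < 0" for s
  proof (rule sum_nonneg)
    fix i assume "i \<in> I"
    with that have "if a i > 0 then s i \<ge> 0 else s i < 0" by blast
    then show "0 \<le> a i * s i"
      by (cases "a i > 0") (auto intro: mult_nonpos_nonpos)
  qed
  have step: "s(b := v) \<in> signed_simplex (insert b I) a r \<longleftrightarrow> v \<in> Y \<and> s \<in> signed_simplex I a (r - a b * v)"
    if s: "s \<in> space (lborel_Pi I)" for s v
  proof -
    have sp: "s(b := v) \<in> space (lborel_Pi (insert b I))"
      using s by (auto simp: space_PiM PiE_def extensional_def)
    have "(\<Sum>i\<in>I. a i * (s(b := v)) i) = (\<Sum>i\<in>I. a i * s i)"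
      using insert.hyps by (intro sum.cong) auto
    moreover have "(\<forall>i\<in>I. if a i > 0 then (s(b := v)) i \<ge> 0 else (s(b := v)) i < 0) \<longleftrightarrow>
        (\<forall>i\<in>I. if a i > 0 then s i \<ge> 0 else s i < 0)"
      using insert.hyps by (intro ball_cong) auto
    ultimately have eq: "s(b := v) \<in> signed_simplex (insert b I) a r \<longleftrightarrow>
        (if a b > 0 then v \<ge> 0 else v < 0) \<and> (\<forall>i\<in>I. if a i > 0 then s i \<ge> 0 else s i < 0) \<and>
        a b * v + (\<Sum>i\<in>I. a i * s i) \<le> r"
      using sp insert.hyps by (simp add: signed_simplex_def)
    show ?thesis
    proof (cases "\<forall>i\<in>I. if a i > 0 then s i \<ge> 0 else s i < 0")
      case True
      then have "a b * v + (\<Sum>i\<in>I. a i * s i) \<le> r \<longleftrightarrow>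
          a b * v \<le> r \<and> (\<Sum>i\<in>I. a i * s i) \<le> r - a b * v"
        using nn[OF True] by linarith
      then show ?thesis
        using True s unfolding eq by (simp only: signed_simplex_def Y_def mem_Collect_eq) blast
    next
      case False
      then show ?thesis unfolding eq by (simp only: signed_simplex_def mem_Collect_eq simp_thms)
    qed
  qed
  have S: "signed_simplex (insert b I) a r \<in> sets (lborel_Pi (insert b I))"
    using insert.hyps by (intro sets_signed_simplex) auto
  have "emeasure (lborel_Pi (insert b I)) (signed_simplex (insert b I) a r)
      = (\<integral>\<^sup>+ s. indicator (signed_simplex (insert b I) a r) s \<partial>lborel_Pi (insert b I))"
    using S by simp
  also have "\<dots> = (\<integral>\<^sup>+ v. \<integral>\<^sup>+ s. indicator (signed_simplex (insert b I) a r) (s(b := v)) \<partial>lborel_Pi I \<partial>lborel)"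
    using insert.hyps S by (intro product_nn_integral_insert_rev) auto
  also have "\<dots> = (\<integral>\<^sup>+ v. \<integral>\<^sup>+ s. indicator Y v * indicator (signed_simplex I a (r - a b * v)) s \<partial>lborel_Pi I \<partial>lborel)"
    using step by (intro nn_integral_cong) (auto simp: indicator_def)
  also have "\<dots> = (\<integral>\<^sup>+ v. indicator Y v * emeasure (lborel_Pi I) (signed_simplex I a (r - a b * v)) \<partial>lborel)"
    using insert.hyps by (intro nn_integral_cong) (simp add: nn_integral_cmult sets_signed_simplex)
  also have "\<dots> = (\<integral>\<^sup>+ v. indicator Y v * ennreal ((r - a b * v) ^ m / C) \<partial>lborel)"
    using insert.IH insert.prems
    by (intro nn_integral_cong) (auto simp: indicator_def m_def C_def Y_def)
  \<comment> \<open>Substituting \<open>v / a b\<close> for \<open>v\<close> turns both sign cases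
    into an integral over \<open>{0..r}\<close>.\<close>
  also have "\<dots> = \<bar>1 / a b\<bar> * (\<integral>\<^sup>+ v. indicator Y (0 + 1 / a b * v) *
      ennreal ((r - a b * (0 + 1 / a b * v)) ^ m / C) \<partial>lborel)"
    using b by (intro nn_integral_real_affine) auto
  also have "(\<integral>\<^sup>+ v. indicator Y (0 + 1 / a b * v) * ennreal ((r - a b * (0 + 1 / a b * v)) ^ m / C) \<partial>lborel)
      = (\<integral>\<^sup>+ v. ennreal ((r - v) ^ m / C) * indicator {0..r} v \<partial>lborel)"
  \<comment> \<open>The integrands may differ at 0, which is excluded from \<open>Y\<close> when
    \<open>a b\<close> is negative.\<close>
  proof (rule nn_integral_cong_AE)
    have Y: "0 + 1 / a b * v \<in> Y \<longleftrightarrow> v \<in> {0..r}" if "v \<noteq> 0" for v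
      using that b by (auto simp: Y_def zero_le_divide_iff divide_less_0_iff)
    have v: "a b * (0 + 1 / a b * v) = v" for v using b by simp
    show "AE v in lborel. indicator Y (0 + 1 / a b * v) *
      ennreal ((r - a b * (0 + 1 / a b * v)) ^ m / C) = ennreal ((r - v) ^ m / C) * indicator {0..r} v"
    proof (rule eventually_mono[OF AE_lborel_singleton[of 0]])
      fix u :: real assume "u \<noteq> 0"
      then have E: "indicator Y (0 + 1 / a b * u) = (indicator {0..r} u :: ennreal)"
        using Y[OF \<open>u \<noteq> 0\<close>] by (simp only: indicator_def)
      show "indicator Y (0 + 1 / a b * u) * ennreal ((r - a b * (0 + 1 / a b * u)) ^ m / C)
          = ennreal ((r - u) ^ m / C) * indicator {0..r} u"
        unfolding E v by (rule mult.commute)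
    qed
  qed
  also have "\<dots> = ennreal (- ((r - r) ^ Suc m / (Suc m * C)) - - ((r - 0) ^ Suc m / (Suc m * C)))"
  proof (rule nn_integral_FTC_Icc)
    fix x assume "x \<in> {0..r}"
    have "((\<lambda>x. - ((r - x) ^ Suc m / (Suc m * C))) has_real_derivative
        - (real (Suc m) * (r - x) ^ m * (0 - 1) / (Suc m * C))) (at x)"
      using C by (auto intro!: derivative_eq_intros simp del: power_Suc)
    also have "- (real (Suc m) * (r - x) ^ m * (0 - 1) / (Suc m * C)) = (r - x) ^ m / C"
      using C by (simp add: divide_simps)
    finally show "((\<lambda>x. - ((r - x) ^ Suc m / (Suc m * C))) has_real_derivative (r - x) ^ m / C) (at x)" .
  qed (use insert.prems C in auto)
  also have "\<bar>1 / a b\<bar> * \<dots> = ennreal (\<bar>1 / a b\<bar> * (r ^ Suc m / (Suc m * C)))"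
    using insert.prems C by (subst ennreal_mult'[symmetric]) auto
  also have "\<bar>1 / a b\<bar> * (r ^ Suc m / (Suc m * C)) =
      r ^ card (insert b I) / (fact (card (insert b I)) * (\<Prod>i\<in>insert b I. \<bar>a i\<bar>))"
    using insert.hyps by (simp add: m_def C_def divide_simps)
  finally show ?case .
qed

section \<open>The polytope as a base polytope\<close>

lemma finite_nonempty_subsets [simp]: "finite (nonempty_subsets n)"
  by (rule finite_subset[of _ "Pow {1..n}"]) (auto simp: nonempty_subsets_def)

text \<open>The support function of the polytope at the indicator vector of \<open>S\<close>.\<close>

definition hit_weight :: "nat \<Rightarrow> (nat set \<Rightarrow> real) \<Rightarrow> nat set \<Rightarrow> real" where
  "hit_weight n y S = (\<Sum>I\<in>nonempty_subsets n. if I \<inter> S \<noteq> {} then y I else 0)"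

lemma hit_weight_alt: "hit_weight n y S = (\<Sum>I | I \<in> nonempty_subsets n \<and> I \<inter> S \<noteq> {}. y I)"
  unfolding hit_weight_def
  by (subst sum.inter_filter[OF finite_nonempty_subsets, symmetric]) (simp add: Int_def)

lemma hit_weight_empty [simp]: "hit_weight n y {} = 0"
  by (simp add: hit_weight_def)

lemma hit_weight_full: "hit_weight n y {1..n} = (\<Sum>I\<in>nonempty_subsets n. y I)"
  unfolding hit_weight_def by (intro sum.cong) (auto simp: nonempty_subsets_def)

lemma hit_weight_mono:
  assumes "\<And>I. I \<in> nonempty_subsets n \<Longrightarrow> y I \<ge> 0" "S \<subseteq> T"
  shows "hit_weight n y S \<le> hit_weight n y T"
  unfolding hit_weight_def using assms by (intro sum_mono) auto

text \<open>Summand by summand: a set meeting \<open>S \<inter> T\<close> meets both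
  \<open>S\<close> and \<open>T\<close>, and a set meeting \<open>S \<union> T\<close> meets at
  least one of them.\<close>

lemma hit_weight_submodular:
  assumes "\<And>I. I \<in> nonempty_subsets n \<Longrightarrow> y I \<ge> 0"
  shows "hit_weight n y (S \<union> T) + hit_weight n y (S \<inter> T) \<le> hit_weight n y S + hit_weight n y T"
  unfolding hit_weight_def sum.distrib[symmetric] using assms by (intro sum_mono) auto

lemma hit_weight_permute:
  assumes w: "w permutes {1..n}"
  shows "hit_weight n y (w ` T) = (\<Sum>I\<in>nonempty_subsets n. if I \<inter> T \<noteq> {} then y (w ` I) else 0)"
  unfolding hit_weight_def
proof (rule sum.reindex_bij_witness[where i = "(`) w" and j = "(`) (inv w)"])
  have inv: "inv w permutes {1..n}" using w by (rule permutes_inv)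
  have sub: "u ` I \<in> nonempty_subsets n" if "u permutes {1..n}" "I \<in> nonempty_subsets n" for u I
    using that permutes_image[OF that(1)] by (auto simp: nonempty_subsets_def)
  have wi: "w ` inv w ` I = I" "inv w ` w ` I = I" for I
    by (simp_all add: image_image permutes_inverses[OF w])
  fix I assume I: "I \<in> nonempty_subsets n"
  show "w ` inv w ` I = I" "inv w ` w ` I = I" by (fact wi)+
  show "inv w ` I \<in> nonempty_subsets n" "w ` I \<in> nonempty_subsets n" using sub I inv w by auto
  have "I \<inter> w ` T = w ` (inv w ` I \<inter> T)"
    by (simp add: image_Int[OF permutes_inj[OF w]] wi)
  then show "(if inv w ` I \<inter> T \<noteq> {} then y (w ` inv w ` I) else 0) = (if I \<inter> w ` T \<noteq> {} then y I else 0)"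
    by (simp add: wi)
qed

section \<open>Points of the simplices and of their Minkowski sum\<close>

lemma lookup_scaleR [simp]: "Poly_Mapping.lookup (a *\<^sub>R t) i = a * Poly_Mapping.lookup (t :: nat \<Rightarrow>\<^sub>0 real) i"
proof -
  have "finite {i. a * Poly_Mapping.lookup t i \<noteq> 0}"
    by (rule finite_subset[OF _ finite_lookup[of t]]) auto
  then show ?thesis by (simp add: scaleR_poly_mapping_def)
qed

text \<open>As \<open>unit_vec\<close> is injective, the convex weights are the coordinates
  themselves.\<close>

lemma coord_simplex_iff:
  assumes I: "finite I"
  shows "s \<in> coord_simplex I \<longleftrightarrow> (\<forall>i. 0 \<le> Poly_Mapping.lookup s i) \<and>
    (\<forall>i. i \<notin> I \<longrightarrow> Poly_Mapping.lookup s i = 0) \<and> (\<Sum>i\<in>I. Poly_Mapping.lookup s i) = 1"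
proof -
  have uv: "Poly_Mapping.lookup (unit_vec i) j = of_bool (i = j)" for i j
    by (simp add: unit_vec_def lookup_single when_def)
  have inj: "inj_on unit_vec I"
  proof (rule inj_onI)
    fix i j assume "unit_vec i = unit_vec j"
    then show "i = j" using uv[of i j] uv[of j j] by (auto split: if_splits)
  qed
  have lk: "Poly_Mapping.lookup (\<Sum>i\<in>I. u i *\<^sub>R unit_vec i) j = (if j \<in> I then u j else 0)" for u j
  proof -
    have "(\<Sum>i\<in>I. u i * of_bool (i = j)) = (\<Sum>i\<in>I. if i = j then u i else 0)"
      by (intro sum.cong) auto
    then show ?thesis using I by (simp add: lookup_sum uv)
  qed
  show ?thesis
  proof
    assume "s \<in> coord_simplex I"
    then obtain u where u: "\<forall>x\<in>unit_vec ` I. 0 \<le> u x" "sum u (unit_vec ` I) = 1"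
      "(\<Sum>x\<in>unit_vec ` I. u x *\<^sub>R x) = s"
      using I by (auto simp: coord_simplex_def convex_hull_finite)
    have "s = (\<Sum>i\<in>I. u (unit_vec i) *\<^sub>R unit_vec i)"
      using u(3) by (simp add: sum.reindex[OF inj])
    then have "Poly_Mapping.lookup s j = (if j \<in> I then u (unit_vec j) else 0)" for j
      using lk by simp
    moreover have "(\<Sum>i\<in>I. u (unit_vec i)) = 1" using u(2) by (simp add: sum.reindex[OF inj])
    ultimately show "(\<forall>i. 0 \<le> Poly_Mapping.lookup s i) \<and>
      (\<forall>i. i \<notin> I \<longrightarrow> Poly_Mapping.lookup s i = 0) \<and> (\<Sum>i\<in>I. Poly_Mapping.lookup s i) = 1"
      using u(1) by auto
  next
    assume s: "(\<forall>i. 0 \<le> Poly_Mapping.lookup s i) \<and>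
      (\<forall>i. i \<notin> I \<longrightarrow> Poly_Mapping.lookup s i = 0) \<and> (\<Sum>i\<in>I. Poly_Mapping.lookup s i) = 1"
    have "s = (\<Sum>i\<in>I. Poly_Mapping.lookup s i *\<^sub>R unit_vec i)"
      using s by (intro poly_mapping_eqI) (auto simp: lk)
    also have "\<dots> = (\<Sum>x\<in>unit_vec ` I. Poly_Mapping.lookup s (inv_into I unit_vec x) *\<^sub>R x)"
      by (simp add: sum.reindex[OF inj] inv_into_f_f[OF inj])
    finally have "(\<Sum>x\<in>unit_vec ` I. Poly_Mapping.lookup s (inv_into I unit_vec x) *\<^sub>R x) = s" ..
    moreover have "(\<Sum>x\<in>unit_vec ` I. Poly_Mapping.lookup s (inv_into I unit_vec x)) = 1"
      using s by (simp add: sum.reindex[OF inj] inv_into_f_f[OF inj])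
    ultimately show "s \<in> coord_simplex I"
      unfolding coord_simplex_def convex_hull_finite[OF finite_imageI[OF I]]
      using s by (intro CollectI exI[of _ "\<lambda>x. Poly_Mapping.lookup s (inv_into I unit_vec x)"]) auto
  qed
qed

lemma mem_gen_permutohedron_iff:
  "t \<in> gen_permutohedron n y \<longleftrightarrow>
    (\<exists>s. (\<forall>I\<in>nonempty_subsets n. s I \<in> coord_simplex I) \<and> t = (\<Sum>I\<in>nonempty_subsets n. y I *\<^sub>R s I))"
proof
  assume "t \<in> gen_permutohedron n y"
  then obtain u where u: "t = (\<Sum>I\<in>nonempty_subsets n. u I)"
    "\<forall>I\<in>nonempty_subsets n. u I \<in> (\<lambda>t. y I *\<^sub>R t) ` coord_simplex I"
    unfolding gen_permutohedron_def set_sum_alt[OF finite_nonempty_subsets] by blast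
  then have "\<forall>I\<in>nonempty_subsets n. \<exists>s. s \<in> coord_simplex I \<and> u I = y I *\<^sub>R s" by blast
  then obtain s where "\<forall>I\<in>nonempty_subsets n. s I \<in> coord_simplex I \<and> u I = y I *\<^sub>R s I"
    by metis
  then show "\<exists>s. (\<forall>I\<in>nonempty_subsets n. s I \<in> coord_simplex I) \<and> t = (\<Sum>I\<in>nonempty_subsets n. y I *\<^sub>R s I)"
    using u(1) by (intro exI[of _ s]) simp
next
  assume "\<exists>s. (\<forall>I\<in>nonempty_subsets n. s I \<in> coord_simplex I) \<and> t = (\<Sum>I\<in>nonempty_subsets n. y I *\<^sub>R s I)"
  then obtain s where "\<forall>I\<in>nonempty_subsets n. s I \<in> coord_simplex I" "t = (\<Sum>I\<in>nonempty_subsets n. y I *\<^sub>R s I)"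
    by blast
  then show "t \<in> gen_permutohedron n y"
    unfolding gen_permutohedron_def set_sum_alt[OF finite_nonempty_subsets]
    by (intro CollectI exI[of _ "\<lambda>I. y I *\<^sub>R s I"]) auto
qed

text \<open>Each simplex has at most weight 1 on \<open>S\<close>, and none if \<open>I\<close>
  misses \<open>S\<close>; this gives one inclusion. For the other, the point is a demand vector to
  be served by supplies \<open>y I\<close> with supports \<open>I\<close>.\<close>

lemma drop_gen_permutohedron_eq:
  assumes n: "n \<ge> 1" and y: "\<And>I. I \<in> nonempty_subsets n \<Longrightarrow> y I \<ge> 0"
  shows "drop_last_coord n ` gen_permutohedron n y =
    {x \<in> space (lborel_Pi {1..<n}). \<forall>S\<subseteq>{1..n}.
       (\<Sum>j\<in>S. lift_last n (hit_weight n y {1..n}) x j) \<le> hit_weight n y S}"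
proof (intro equalityI subsetI)
  let ?c = "hit_weight n y {1..n}"
  have fI: "finite I" "I \<noteq> {}" "I \<subseteq> {1..n}" if "I \<in> nonempty_subsets n" for I
    using that by (auto simp: nonempty_subsets_def intro: finite_subset)
  fix x assume "x \<in> drop_last_coord n ` gen_permutohedron n y"
  then obtain t where t: "x = drop_last_coord n t" "t \<in> gen_permutohedron n y" by auto
  then obtain s where "\<forall>I\<in>nonempty_subsets n. s I \<in> coord_simplex I"
    and ts: "t = (\<Sum>I\<in>nonempty_subsets n. y I *\<^sub>R s I)"
    by (auto simp: mem_gen_permutohedron_iff)
  then have s: "0 \<le> Poly_Mapping.lookup (s I) i" "i \<notin> I \<Longrightarrow> Poly_Mapping.lookup (s I) i = 0"
    "(\<Sum>i\<in>I. Poly_Mapping.lookup (s I) i) = 1" if "I \<in> nonempty_subsets n" for I i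
    using that coord_simplex_iff[OF fI(1)] by auto
  have lt: "Poly_Mapping.lookup t j = (\<Sum>I\<in>nonempty_subsets n. y I * Poly_Mapping.lookup (s I) j)" for j
    by (simp add: ts lookup_sum)
  have sumt: "(\<Sum>j\<in>S. Poly_Mapping.lookup t j) =
      (\<Sum>I\<in>nonempty_subsets n. y I * (\<Sum>j\<in>S. Poly_Mapping.lookup (s I) j))" for S
    unfolding lt sum_distrib_left by (rule sum.swap)
  have sS: "(\<Sum>j\<in>S. Poly_Mapping.lookup (s I) j) = (\<Sum>j\<in>I \<inter> S. Poly_Mapping.lookup (s I) j)"
    if "I \<in> nonempty_subsets n" "finite S" for I S
    using that s(2) by (intro sum.mono_neutral_right) auto
  have "(\<Sum>j\<in>{1..n}. Poly_Mapping.lookup (s I) j) = 1" if "I \<in> nonempty_subsets n" for I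
    using sS[OF that, of "{1..n}"] fI(3)[OF that] s(3)[OF that] by (simp add: Int_absorb2)
  then have total: "(\<Sum>j\<in>{1..n}. Poly_Mapping.lookup t j) = ?c"
    unfolding sumt hit_weight_full by (intro sum.cong) (simp_all only: mult_1_right)
  have "{1..n} = insert n {1..<n}" using n by auto
  then have "Poly_Mapping.lookup t n = ?c - (\<Sum>j\<in>{1..<n}. Poly_Mapping.lookup t j)"
    using total by simp
  then have lift: "lift_last n ?c x j = Poly_Mapping.lookup t j" if "j \<in> {1..n}" for j
    using that by (auto simp: lift_last_def t(1) drop_last_coord_def)
  have "(\<Sum>j\<in>S. lift_last n ?c x j) \<le> hit_weight n y S" if S: "S \<subseteq> {1..n}" for S
  proof -
    have fS: "finite S" using S by (auto intro: finite_subset)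
    have "(\<Sum>j\<in>S. lift_last n ?c x j) = (\<Sum>j\<in>S. Poly_Mapping.lookup t j)"
      using S lift by (intro sum.cong) auto
    also have "\<dots> \<le> hit_weight n y S"
      unfolding sumt hit_weight_def
    proof (rule sum_mono)
      fix I assume I: "I \<in> nonempty_subsets n"
      have "(\<Sum>j\<in>I \<inter> S. Poly_Mapping.lookup (s I) j) \<le> (\<Sum>j\<in>I. Poly_Mapping.lookup (s I) j)"
        using fI(1)[OF I] s(1)[OF I] by (intro sum_mono2) auto
      then have "(\<Sum>j\<in>S. Poly_Mapping.lookup (s I) j) \<le> 1"
        using sS[OF I fS] s(3)[OF I] by simp
      then have "y I * (\<Sum>j\<in>S. Poly_Mapping.lookup (s I) j) \<le> y I"
        using y[OF I] by (simp add: mult_left_le)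
      moreover have "(\<Sum>j\<in>S. Poly_Mapping.lookup (s I) j) = 0" if "I \<inter> S = {}"
        using sS[OF I fS] that by simp
      ultimately show "y I * (\<Sum>j\<in>S. Poly_Mapping.lookup (s I) j) \<le> (if I \<inter> S \<noteq> {} then y I else 0)"
        by auto
    qed
    finally show ?thesis .
  qed
  moreover have "x \<in> space (lborel_Pi {1..<n})"
    by (auto simp: t(1) drop_last_coord_def space_PiM)
  ultimately show "x \<in> {x \<in> space (lborel_Pi {1..<n}). \<forall>S\<subseteq>{1..n}.
       (\<Sum>j\<in>S. lift_last n ?c x j) \<le> hit_weight n y S}" by blast
next
  let ?c = "hit_weight n y {1..n}"
  have fI: "finite I" "I \<noteq> {}" "I \<subseteq> {1..n}" if "I \<in> nonempty_subsets n" for I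
    using that by (auto simp: nonempty_subsets_def intro: finite_subset)
  fix x assume "x \<in> {x \<in> space (lborel_Pi {1..<n}). \<forall>S\<subseteq>{1..n}.
       (\<Sum>j\<in>S. lift_last n ?c x j) \<le> hit_weight n y S}"
  then have x: "x \<in> space (lborel_Pi {1..<n})"
    "\<And>S. S \<subseteq> {1..n} \<Longrightarrow> (\<Sum>j\<in>S. lift_last n ?c x j) \<le> hit_weight n y S" by auto
  have "\<exists>z. (\<forall>I\<in>nonempty_subsets n. \<forall>g\<in>{1..n}. 0 \<le> z I g \<and> (g \<notin> I \<longrightarrow> z I g = 0)) \<and>
           (\<forall>I\<in>nonempty_subsets n. (\<Sum>g\<in>{1..n}. z I g) = y I) \<and>
           (\<forall>g\<in>{1..n}. (\<Sum>I\<in>nonempty_subsets n. z I g) = lift_last n ?c x g)"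
  proof (rule transport_feasible)
    show "(\<Sum>g\<in>{1..n}. lift_last n ?c x g) = (\<Sum>I\<in>nonempty_subsets n. y I)"
      unfolding hit_weight_full[symmetric] by (rule sum_lift_last[OF n])
    show "(\<Sum>g\<in>S. lift_last n ?c x g) \<le> (\<Sum>I | I \<in> nonempty_subsets n \<and> I \<inter> S \<noteq> {}. y I)"
      if "S \<subseteq> {1..n}" for S
      unfolding hit_weight_alt[symmetric] by (rule x(2)[OF that])
  qed (use y fI in auto)
  then obtain z where z: "\<And>I g. I \<in> nonempty_subsets n \<Longrightarrow> g \<in> {1..n} \<Longrightarrow> 0 \<le> z I g"
    "\<And>I g. I \<in> nonempty_subsets n \<Longrightarrow> g \<in> {1..n} \<Longrightarrow> g \<notin> I \<Longrightarrow> z I g = 0"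
    "\<And>I. I \<in> nonempty_subsets n \<Longrightarrow> (\<Sum>g\<in>{1..n}. z I g) = y I"
    "\<And>g. g \<in> {1..n} \<Longrightarrow> (\<Sum>I\<in>nonempty_subsets n. z I g) = lift_last n ?c x g"
    by blast
  \<comment> \<open>The shipments of \<open>I\<close> divided by \<open>y I\<close> are convex
    weights. If \<open>y I = 0\<close>, all shipments of \<open>I\<close> vanish and any point of
    the simplex serves.\<close>
  define s where "s I = (if y I = 0 then unit_vec (Min I) else (\<Sum>i\<in>I. (z I i / y I) *\<^sub>R unit_vec i))" for I
  have lk: "Poly_Mapping.lookup (\<Sum>i\<in>I. u i *\<^sub>R unit_vec i) j = (if j \<in> I then u j else 0)"
    if "finite I" for u j and I :: "nat set"
  proof -
    have "(\<Sum>i\<in>I. u i * (1 when i = j)) = (\<Sum>i\<in>I. if i = j then u i else 0)"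
      by (intro sum.cong) auto
    then show ?thesis using that by (simp add: lookup_sum unit_vec_def lookup_single)
  qed
  have zI: "(\<Sum>i\<in>I. z I i) = y I" if "I \<in> nonempty_subsets n" for I
    using fI[OF that] z(2)[OF that] by (subst z(3)[OF that, symmetric], intro sum.mono_neutral_left) auto
  have s_mem: "s I \<in> coord_simplex I" if I: "I \<in> nonempty_subsets n" for I
  proof (cases "y I = 0")
    case True
    have "Min I \<in> I" using fI[OF I] by (intro Min_in)
    then show ?thesis using True by (simp add: s_def coord_simplex_def hull_inc)
  next
    case False
    have "0 \<le> z I i" if "i \<in> I" for i using that z(1)[OF I] fI(3)[OF I] by auto
    moreover have "(\<Sum>i\<in>I. z I i / y I) = 1"
      using zI[OF I] False by (simp flip: sum_divide_distrib)
    ultimately show ?thesis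
      using False y[OF I] fI(1)[OF I] by (subst coord_simplex_iff) (auto simp: s_def lk)
  qed
  have ys: "y I * Poly_Mapping.lookup (s I) j = z I j" if I: "I \<in> nonempty_subsets n" and j: "j \<in> {1..n}" for I j
  proof (cases "y I = 0")
    case True
    have "(\<Sum>g\<in>{1..n}. z I g) = 0" using z(3)[OF I] True by (rule trans)
    from sum_nonneg_0[OF finite_atLeastAtMost z(1)[OF I] this j]
    show ?thesis using True by simp
  next
    case False
    then show ?thesis using z(2)[OF I j] fI(1)[OF I] by (simp add: s_def lk)
  qed
  define t where "t = (\<Sum>I\<in>nonempty_subsets n. y I *\<^sub>R s I)"
  have "t \<in> gen_permutohedron n y"
    using s_mem by (auto simp: mem_gen_permutohedron_iff t_def)
  moreover have "x = drop_last_coord n t"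
  proof
    fix j
    show "x j = drop_last_coord n t j"
    proof (cases "j \<in> {1..<n}")
      case True
      then have "Poly_Mapping.lookup t j = lift_last n ?c x j"
        using z(4)[of j] by (auto simp: t_def lookup_sum ys)
      then show ?thesis using True by (simp add: drop_last_coord_def lift_last_def)
    next
      case False
      then show ?thesis using x(1) by (auto simp: drop_last_coord_def space_PiM PiE_def extensional_def)
    qed
  qed
  ultimately show "x \<in> drop_last_coord n ` gen_permutohedron n y" by blast
qed

section \<open>Cone decomposition and volume\<close>

lemma abel_summation:
  fixes l a :: "nat \<Rightarrow> real"
  assumes "n \<ge> 1"
  shows "(\<Sum>m\<in>{1..n}. l m * a m) =
    (\<Sum>i\<in>{1..<n}. (l i - l (i + 1)) * (\<Sum>m\<in>{1..i}. a m)) + l n * (\<Sum>m\<in>{1..n}. a m)"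
  using assms
proof (induction n rule: nat_induct_at_least)
  case (Suc n)
  then have "{1..<Suc n} = insert n {1..<n}" by auto
  then show ?case using Suc by (simp add: algebra_simps)
qed simp

text \<open>The map is injective into the lists, and both sides have \<open>n\<close> factorial
  elements.\<close>

lemma permutations_of_set_eq_image:
  "permutations_of_set {1..n} = (\<lambda>w. map w [1..<Suc n]) ` {w. w permutes {1..n}}"
  and inj_on_map_permutes: "inj_on (\<lambda>w. map w [1..<Suc n]) {w. w permutes {1..n}}"
proof -
  let ?f = "\<lambda>w. map w [1..<Suc n]"
  show inj: "inj_on ?f {w. w permutes {1..n}}"
  proof (rule inj_onI)
    fix u w assume u: "u \<in> {w. w permutes {1..n}}" and w: "w \<in> {w. w permutes {1..n}}" and "?f u = ?f w"
    then have "\<forall>i\<in>set [1..<Suc n]. u i = w i" by (simp only: map_eq_conv)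
    then have "u i = w i" if "i \<in> {1..n}" for i using that by (auto simp del: upt_Suc)
    moreover have "u i = w i" if "i \<notin> {1..n}" for i using that u w by (simp add: permutes_not_in)
    ultimately show "u = w" by blast
  qed
  have "?f w \<in> permutations_of_set {1..n}" if "w permutes {1..n}" for w
  proof (rule permutations_of_setI)
    have "set [1..<Suc n] = {1..n}" by auto
    then show "set (?f w) = {1..n}" using permutes_image[OF that] by (simp only: set_map)
    show "distinct (?f w)" using permutes_inj[OF that] by (auto simp: distinct_map intro: inj_on_subset)
  qed
  moreover have "card (?f ` {w. w permutes {1..n}}) = card (permutations_of_set {1..n})"
    by (simp only: card_image[OF inj] card_permutations[OF refl finite_atLeastAtMost] card_permutations_of_set finite_atLeastAtMost)
  ultimately show "permutations_of_set {1..n} = ?f ` {w. w permutes {1..n}}"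
    by (intro card_subset_eq[symmetric]) auto
qed

lemma desc_weight_map:
  assumes w: "w permutes {1..n}" and k: "1 \<le> k" "k \<le> n"
  shows "desc_weight lam N (map w [k..<Suc n]) =
    (\<Prod>i\<in>{k..<n}. of_bool (lam (w (i + 1)) < lam (w i)) - of_bool ({1..n} - w ` {1..i} \<in> N))"
  using k(2,1)
proof (induction rule: inc_induct)
  case base
  then show ?case by simp
next
  case (step k)
  have s: "set (map w [Suc k..<Suc n]) = {1..n} - w ` {1..k}"
  proof -
    have "{1..n} - w ` {1..k} = w ` {1..n} - w ` {1..k}" using permutes_image[OF w] by simp
    also have "\<dots> = w ` ({1..n} - {1..k})" by (rule image_set_diff[OF permutes_inj[OF w], symmetric])
    also have "{1..n} - {1..k} = set [Suc k..<Suc n]" using step by auto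
    finally show ?thesis by (simp only: set_map)
  qed
  have u: "[k..<Suc n] = k # Suc k # [Suc (Suc k)..<Suc n]" "[Suc k..<Suc n] = Suc k # [Suc (Suc k)..<Suc n]"
    using step by (auto simp: upt_rec)
  have "desc_weight lam N (map w [k..<Suc n]) =
     (of_bool (lam (w (k + 1)) < lam (w k)) - of_bool (set (map w [Suc k..<Suc n]) \<in> N)) *
     desc_weight lam N (map w [Suc k..<Suc n])"
    unfolding u by simp
  also have "desc_weight lam N (map w [Suc k..<Suc n]) =
    (\<Prod>i\<in>{Suc k..<n}. of_bool (lam (w (i + 1)) < lam (w i)) - of_bool ({1..n} - w ` {1..i} \<in> N))"
    using step by simp
  finally show ?case
    unfolding s using step by (simp add: prod.atLeast_Suc_lessThan)
qed

text \<open>For fixed \<open>w\<close>, the product is up to sign the indicator function of the tangent cone at a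
  vertex, with its edges flipped so that \<open>lam\<close> is bounded above on it.\<close>

lemma submodular_cone_decomposition:
  fixes D :: "nat set \<Rightarrow> real" and lam :: "nat \<Rightarrow> real"
  assumes n: "n \<ge> 1" and inj: "inj_on lam {1..n}"
    and D0: "D {} = 0" "D {1..n} = 0"
    and sm: "\<And>S T. S \<subseteq> {1..n} \<Longrightarrow> T \<subseteq> {1..n} \<Longrightarrow> D (S \<union> T) + D (S \<inter> T) \<le> D S + D T"
  shows "(\<Sum>w | w permutes {1..n}. \<Prod>i\<in>{1..<n}.
      of_bool (lam (w (i + 1)) < lam (w i)) - of_bool (D (w ` {1..i}) < 0)) =
    (of_bool (\<forall>S\<subseteq>{1..n}. 0 \<le> D S) :: real)"
proof -
  let ?G = "{1..n}"
  define N where "N = {S. S \<subseteq> ?G \<and> D (?G - S) < 0}"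
  have W: "(\<Prod>i\<in>{1..<n}. of_bool (lam (w (i + 1)) < lam (w i)) - of_bool (D (w ` {1..i}) < 0)) =
      desc_weight lam N (map w [1..<Suc n])" if w: "w permutes ?G" for w
  proof -
    have "?G - w ` {1..i} \<in> N \<longleftrightarrow> D (w ` {1..i}) < 0" if "i \<in> {1..<n}" for i
    proof -
      have "w ` {1..i} \<subseteq> w ` ?G" using that by (intro image_mono) auto
      then have "w ` {1..i} \<subseteq> ?G" using permutes_image[OF w] by simp
      then show ?thesis by (auto simp: N_def double_diff)
    qed
    then show ?thesis
      using n by (subst desc_weight_map[OF w]) (auto intro!: prod.cong)
  qed
  have "(\<Sum>w | w permutes ?G. \<Prod>i\<in>{1..<n}.
      of_bool (lam (w (i + 1)) < lam (w i)) - of_bool (D (w ` {1..i}) < 0)) = desc_sum lam N ?G"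
    unfolding desc_sum_def permutations_of_set_eq_image sum.reindex[OF inj_on_map_permutes] o_def
    by (intro sum.cong refl W) simp
  also have "\<dots> = of_bool (\<forall>S\<subseteq>?G. 0 \<le> D S)"
  proof (cases "\<forall>S\<subseteq>?G. 0 \<le> D S")
    case True
    have e: "N \<inter> Pow ?G = {}"
    proof (rule equals0I)
      fix S assume "S \<in> N \<inter> Pow ?G"
      then have "D (?G - S) < 0" by (simp add: N_def)
      moreover have "0 \<le> D (?G - S)" using True by blast
      ultimately show False by simp
    qed
    have "desc_sum lam N ?G = 1"
      by (rule desc_sum_empty_family[OF _ _ inj e]) (use n in simp_all)
    moreover have "(\<forall>S\<subseteq>?G. 0 \<le> D S) = True" using True by blast
    ultimately show ?thesis by (simp only: of_bool_eq)
  next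
    case False
    then obtain S0 where S0: "S0 \<subseteq> ?G" "D S0 < 0" by (auto simp: not_le)
    \<comment> \<open>\<open>C\<close> minimises \<open>D\<close>.\<close>
    obtain C where C: "C \<in> Pow ?G" "\<forall>S\<in>Pow ?G. - D S \<le> - D C"
      using ex_max_on[of "Pow ?G" "\<lambda>S. - D S"] by auto
    have "- D S0 \<le> - D C" using C(2) S0(1) by blast
    then have DC: "D C < 0" using S0(2) by linarith
    have "desc_sum lam N ?G = 0"
    proof (rule desc_sum_conical_family[where B = "?G - C"])
      show "?G - C \<in> N" using C DC by (auto simp: N_def double_diff)
      show "A \<union> (?G - C) \<in> N" if "A \<in> N" for A
      proof -
        have A: "A \<subseteq> ?G" "D (?G - A) < 0" using that by (auto simp: N_def)
        \<comment> \<open>Submodularity and minimality of \<open>C\<close> bound the slack of the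
          intersection with \<open>C\<close> by that of \<open>?G - A\<close>, which is negative. In
          complements, intersecting with \<open>C\<close> is joining with
          \<open>?G - C\<close>.\<close>
        have "D ((?G - A) \<union> C) + D ((?G - A) \<inter> C) \<le> D (?G - A) + D C"
          using C by (intro sm) auto
        moreover have "- D ((?G - A) \<union> C) \<le> - D C" using C by blast
        ultimately have "D ((?G - A) \<inter> C) < 0" using A by linarith
        moreover have "?G - (A \<union> (?G - C)) = (?G - A) \<inter> C" using C by auto
        ultimately show ?thesis using A by (auto simp: N_def)
      qed
    qed (use inj D0 in \<open>auto simp: N_def\<close>)
    moreover have "(\<forall>S\<subseteq>?G. 0 \<le> D S) = False" using False by blast
    ultimately show ?thesis by (simp only: of_bool_eq)
  qed
  finally show ?thesis .
qed

section \<open>The linear functional along a chain, and the truncated volume\<close>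

text \<open>The left side is the value of \<open>lam\<close> at the vertex belonging to
  \<open>w\<close>, where all slacks along the chain vanish; the identity is Abel summation of its
  coordinates.\<close>

lemma sum_lam_min_eq:
  fixes lam :: "nat \<Rightarrow> real"
  assumes n: "n \<ge> 1" and w: "w permutes {1..n}"
  shows "(\<Sum>I\<in>nonempty_subsets n. lam (w (Min I)) * y (w ` I)) =
    (\<Sum>i\<in>{1..<n}. (lam (w i) - lam (w (i + 1))) * hit_weight n y (w ` {1..i})) +
    lam (w n) * hit_weight n y {1..n}"
proof -
  have Min: "Min I \<in> {1..n}" "Min I \<in> I" "finite I" if "I \<in> nonempty_subsets n" for I
  proof -
    show "finite I" using that by (auto simp: nonempty_subsets_def intro: finite_subset)
    then show "Min I \<in> I" using that by (intro Min_in) (auto simp: nonempty_subsets_def)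
    then show "Min I \<in> {1..n}" using that by (auto simp: nonempty_subsets_def)
  qed
  define a where "a m = (\<Sum>I | I \<in> nonempty_subsets n \<and> Min I = m. y (w ` I))" for m
  have pre: "(\<Sum>m\<in>{1..i}. a m) = hit_weight n y (w ` {1..i})" if "i \<le> n" for i
  proof -
    have "(\<Sum>m\<in>{1..i}. a m) =
        (\<Sum>m\<in>{1..i}. \<Sum>I | I \<in> {I \<in> nonempty_subsets n. Min I \<le> i} \<and> Min I = m. y (w ` I))"
      unfolding a_def by (intro sum.cong) auto
    also have "\<dots> = (\<Sum>I | I \<in> nonempty_subsets n \<and> Min I \<le> i. y (w ` I))"
      using Min by (intro sum.group) auto
    also have "\<dots> = (\<Sum>I\<in>nonempty_subsets n. if Min I \<le> i then y (w ` I) else 0)"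
      by (rule sum.inter_filter) simp
    also have "\<dots> = (\<Sum>I\<in>nonempty_subsets n. if I \<inter> {1..i} \<noteq> {} then y (w ` I) else 0)"
    proof (intro sum.cong refl)
      fix I assume I: "I \<in> nonempty_subsets n"
      have "Min I \<le> i \<longleftrightarrow> I \<inter> {1..i} \<noteq> {}"
      proof
        assume "Min I \<le> i"
        then have "Min I \<in> I \<inter> {1..i}" using Min[OF I] by auto
        then show "I \<inter> {1..i} \<noteq> {}" by blast
      next
        assume "I \<inter> {1..i} \<noteq> {}"
        then obtain j where "j \<in> I" "j \<le> i" by auto
        then show "Min I \<le> i" using Min_le[OF Min(3)[OF I], of j] by linarith
      qed
      then show "(if Min I \<le> i then y (w ` I) else 0) = (if I \<inter> {1..i} \<noteq> {} then y (w ` I) else 0)"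
        by simp
    qed
    also have "\<dots> = hit_weight n y (w ` {1..i})" by (rule hit_weight_permute[OF w, symmetric])
    finally show ?thesis .
  qed
  have "(\<Sum>I\<in>nonempty_subsets n. lam (w (Min I)) * y (w ` I)) =
      (\<Sum>m\<in>{1..n}. \<Sum>I | I \<in> nonempty_subsets n \<and> Min I = m. lam (w (Min I)) * y (w ` I))"
    using Min by (intro sum.group[symmetric]) auto
  also have "\<dots> = (\<Sum>m\<in>{1..n}. lam (w m) * a m)"
    unfolding a_def sum_distrib_left by (intro sum.cong) auto
  also have "\<dots> = (\<Sum>i\<in>{1..<n}. (lam (w i) - lam (w (i + 1))) * (\<Sum>m\<in>{1..i}. a m)) +
      lam (w n) * (\<Sum>m\<in>{1..n}. a m)"
    by (rule abel_summation[OF n])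
  also have "(\<Sum>m\<in>{1..n}. a m) = hit_weight n y {1..n}"
    using pre[of n] permutes_image[OF w] by simp
  also have "(\<Sum>i\<in>{1..<n}. (lam (w i) - lam (w (i + 1))) * (\<Sum>m\<in>{1..i}. a m)) =
      (\<Sum>i\<in>{1..<n}. (lam (w i) - lam (w (i + 1))) * hit_weight n y (w ` {1..i}))"
    using pre by (intro sum.cong) auto
  finally show ?thesis .
qed

text \<open>In slack coordinates the drop of \<open>lam\<close> from the vertex to the point is a
  linear form with coefficients \<open>lam (w i) - lam (w (i + 1))\<close>. So the half-space
  condition bounds this form by \<open>R\<close> plus the vertex value.\<close>

lemma sum_chain_coords:
  fixes lam :: "nat \<Rightarrow> real"
  assumes n: "n \<ge> 1" and w: "w permutes {1..n}"
  shows "(\<Sum>i\<in>{1..<n}. (lam (w i) - lam (w (i + 1))) *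
      chain_coords n (hit_weight n y {1..n}) (\<lambda>i. hit_weight n y (w ` {1..i})) w x i) =
    (\<Sum>I\<in>nonempty_subsets n. lam (w (Min I)) * y (w ` I)) -
    (\<Sum>j\<in>{1..n}. lam j * lift_last n (hit_weight n y {1..n}) x j)"
proof -
  let ?t = "lift_last n (hit_weight n y {1..n}) x"
  have p: "(\<Sum>m\<in>{1..n}. f (w m)) = (\<Sum>j\<in>{1..n}. f j)" for f :: "nat \<Rightarrow> real"
    using sum.permute[OF w, of f] by (simp add: o_def)
  have "(\<Sum>j\<in>{1..n}. lam j * ?t j) = (\<Sum>m\<in>{1..n}. lam (w m) * ?t (w m))"
    by (rule p[symmetric])
  also have "\<dots> = (\<Sum>i\<in>{1..<n}. (lam (w i) - lam (w (i + 1))) * (\<Sum>m\<in>{1..i}. ?t (w m))) +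
      lam (w n) * (\<Sum>m\<in>{1..n}. ?t (w m))"
    by (rule abel_summation[OF n])
  also have "(\<Sum>m\<in>{1..n}. ?t (w m)) = hit_weight n y {1..n}"
    using sum_lift_last[OF n] by (simp only: p)
  finally show ?thesis
    unfolding sum_lam_min_eq[OF n w]
    by (simp add: chain_coords_def right_diff_distrib sum_subtractf)
qed

text \<open>The constraint at \<open>{j}\<close> bounds the coordinate above; the one at the
  complement of \<open>{j}\<close>, with the fixed total, shows that it is nonnegative.\<close>

lemma abs_lift_last_le:
  assumes n: "n \<ge> 1" and y: "\<And>I. I \<in> nonempty_subsets n \<Longrightarrow> y I \<ge> 0"
    and x: "\<And>S. S \<subseteq> {1..n} \<Longrightarrow> (\<Sum>j\<in>S. lift_last n (hit_weight n y {1..n}) x j) \<le> hit_weight n y S"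
    and j: "j \<in> {1..n}"
  shows "\<bar>lift_last n (hit_weight n y {1..n}) x j\<bar> \<le> hit_weight n y {1..n}"
proof -
  let ?c = "hit_weight n y {1..n}"
  let ?t = "lift_last n ?c x"
  have "?t j \<le> hit_weight n y {j}" using x[of "{j}"] j by simp
  also have "\<dots> \<le> ?c" using y j by (intro hit_weight_mono) auto
  finally have "?t j \<le> ?c" .
  have "(\<Sum>i\<in>{1..n} - {j}. ?t i) \<le> hit_weight n y ({1..n} - {j})" by (rule x) auto
  also have "\<dots> \<le> ?c" using y by (intro hit_weight_mono) auto
  finally have "0 \<le> ?t j" using sum_lift_last[OF n, of ?c x] j by (simp add: sum_diff1)
  with \<open>?t j \<le> ?c\<close> show ?thesis by simp
qed

text \<open>The half-space \<open>lam \<bullet> t \<ge> - R\<close> contains the polytope and cuts each flipped cone down to a simplex.\<close>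

lemma Vol_eq_truncated:
  fixes lam :: "nat \<Rightarrow> real"
  assumes n: "n \<ge> 1" and y: "\<And>I. I \<in> nonempty_subsets n \<Longrightarrow> y I \<ge> 0"
    and inj: "inj_on lam {1..n}"
    and R1: "(\<Sum>j\<in>{1..n}. \<bar>lam j\<bar>) * hit_weight n y {1..n} \<le> R"
    and R2: "\<And>w. w permutes {1..n} \<Longrightarrow> 0 \<le> R + (\<Sum>I\<in>nonempty_subsets n. lam (w (Min I)) * y (w ` I))"
  shows "Vol n (gen_permutohedron n y) =
    1 / fact (n - 1) * (\<Sum>w | w permutes {1..n}.
      (R + (\<Sum>I\<in>nonempty_subsets n. lam (w (Min I)) * y (w ` I))) ^ (n - 1) /
      (\<Prod>i\<in>{1..<n}. lam (w i) - lam (w (i + 1))))"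
proof -
  let ?G = "{1..n}" let ?M = "lborel_Pi {1..<n}"
  let ?h = "hit_weight n y"
  let ?c = "?h ?G"
  define P where "P = drop_last_coord n ` gen_permutohedron n y"
  define L where "L w = (\<Sum>I\<in>nonempty_subsets n. lam (w (Min I)) * y (w ` I))" for w
  define a where "a w i = lam (w i) - lam (w (i + 1))" for w :: "nat \<Rightarrow> nat" and i
  define \<Phi> where "\<Phi> w = chain_coords n ?c (\<lambda>i. ?h (w ` {1..i})) w" for w
  define C where "C w = \<Phi> w -` signed_simplex {1..<n} (a w) (R + L w) \<inter> space ?M" for w
  have P_eq: "P = {x \<in> space ?M. \<forall>S\<subseteq>?G. (\<Sum>j\<in>S. lift_last n ?c x j) \<le> ?h S}"
    unfolding P_def using n y by (rule drop_gen_permutohedron_eq)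
  have a0: "a w i \<noteq> 0" if "w permutes ?G" "i \<in> {1..<n}" for w i
  proof -
    have "w i \<in> ?G" "w (i + 1) \<in> ?G" using that permutes_in_image[OF that(1)] by auto
    moreover have "w i \<noteq> w (i + 1)" 
      using permutes_inj[OF that(1)] by (metis add_cancel_right_right injD one_neq_zero)
    ultimately show ?thesis using inj by (auto simp: a_def dest: inj_onD)
  qed
  have C: "C w \<in> sets ?M" "emeasure ?M (C w) =
      ennreal ((R + L w) ^ (n - 1) / (fact (n - 1) * (\<Prod>i\<in>{1..<n}. \<bar>a w i\<bar>)))"
    if w: "w permutes ?G" for w
  proof -
    have \<Phi>: "\<Phi> w \<in> ?M \<rightarrow>\<^sub>M ?M" "distr ?M ?M (\<Phi> w) = ?M"
      using chain_coords_measure_preserving[OF n w] by (auto simp: \<Phi>_def)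
    have S: "signed_simplex {1..<n} (a w) (R + L w) \<in> sets ?M" by (rule sets_signed_simplex) simp
    show "C w \<in> sets ?M" unfolding C_def using \<Phi>(1) S by (rule measurable_sets)
    have "emeasure ?M (C w) = emeasure (distr ?M ?M (\<Phi> w)) (signed_simplex {1..<n} (a w) (R + L w))"
      unfolding C_def using \<Phi>(1) S by (rule emeasure_distr[symmetric])
    also have "\<dots> = ennreal ((R + L w) ^ (n - 1) / (fact (n - 1) * (\<Prod>i\<in>{1..<n}. \<bar>a w i\<bar>)))"
      unfolding \<Phi>(2) using a0[OF w] R2[OF w]
      by (subst emeasure_signed_simplex) (auto simp: L_def)
    finally show "emeasure ?M (C w) =
      ennreal ((R + L w) ^ (n - 1) / (fact (n - 1) * (\<Prod>i\<in>{1..<n}. \<bar>a w i\<bar>)))" .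
  qed
  have ind: "indicator P x = (\<Sum>w | w permutes ?G. (\<Prod>i\<in>{1..<n}. sgn (a w i)) * indicator (C w) x)"
    (is "_ = (\<Sum>w | w permutes ?G. ?f w)") if x: "x \<in> space ?M" for x
  proof -
    define D where "D S = ?h S - (\<Sum>j\<in>S. lift_last n ?c x j)" for S
    define l where "l = (\<Sum>j\<in>?G. lam j * lift_last n ?c x j)"
    have xP: "x \<in> P \<longleftrightarrow> (\<forall>S\<subseteq>?G. 0 \<le> D S)" using x by (simp add: P_eq D_def)
    have sm: "D (S \<union> T) + D (S \<inter> T) \<le> D S + D T" if "S \<subseteq> ?G" "T \<subseteq> ?G" for S T
    proof -
      have "finite S" "finite T" using that by (auto intro: finite_subset)
      moreover have "?h (S \<union> T) + ?h (S \<inter> T) \<le> ?h S + ?h T"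
        using y by (rule hit_weight_submodular)
      ultimately show ?thesis
        using sum.union_inter[of S T "lift_last n ?c x"]
        by (simp add: D_def)
    qed
    have DG: "D {} = 0" "D ?G = 0" using sum_lift_last[OF n] by (simp_all add: D_def)
    have dec: "(\<Sum>w | w permutes ?G. \<Prod>i\<in>{1..<n}.
      of_bool (lam (w (i + 1)) < lam (w i)) - of_bool (D (w ` {1..i}) < 0)) =
      (of_bool (\<forall>S\<subseteq>?G. 0 \<le> D S) :: real)"
      by (rule submodular_cone_decomposition[OF n inj DG]) (rule sm)
    have "l \<ge> - R" if "x \<in> P"
    proof -
      have "- l \<le> \<bar>l\<bar>" by simp
      also have "\<dots> \<le> (\<Sum>j\<in>?G. \<bar>lam j * lift_last n ?c x j\<bar>)" unfolding l_def by (rule sum_abs)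
      also have "\<dots> \<le> (\<Sum>j\<in>?G. \<bar>lam j\<bar> * ?c)"
        unfolding abs_mult using that
        by (intro sum_mono mult_left_mono abs_lift_last_le[OF n y]) (auto simp: P_eq)
      also have "\<dots> \<le> R" using R1 by (simp add: sum_distrib_right)
      finally show ?thesis by simp
    qed
    then have "indicator P x = of_bool (\<forall>S\<subseteq>?G. 0 \<le> D S) * (of_bool (- R \<le> l) :: real)"
      by (auto simp: xP indicator_def)
    also have "\<dots> = (\<Sum>w | w permutes ?G. (\<Prod>i\<in>{1..<n}.
      of_bool (lam (w (i + 1)) < lam (w i)) - of_bool (D (w ` {1..i}) < 0)) * of_bool (- R \<le> l))"
      unfolding dec[symmetric] by (rule sum_distrib_right)
    also have "\<dots> = (\<Sum>w | w permutes ?G. ?f w)"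
    proof (intro sum.cong refl)
      fix w assume "w \<in> {w. w permutes ?G}"
      then have w: "w permutes ?G" by simp
      let ?Q = "\<lambda>i. if a w i > 0 then D (w ` {1..i}) \<ge> 0 else D (w ` {1..i}) < 0"
      have \<Phi>D: "\<Phi> w x i = D (w ` {1..i})" if "i \<in> {1..<n}" for i
      proof -
        have "(\<Sum>j\<in>w ` {1..i}. lift_last n ?c x j) = (\<Sum>m\<in>{1..i}. lift_last n ?c x (w m))"
          by (subst sum.reindex) (auto intro: inj_on_subset[OF permutes_inj[OF w]])
        then show ?thesis using that by (simp add: \<Phi>_def chain_coords_def D_def)
      qed
      have \<Phi>x: "\<Phi> w x \<in> space ?M"
        using measurable_space[OF conjunct1[OF chain_coords_measure_preserving[OF n w]] x]
        by (simp add: \<Phi>_def)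
      have "(\<Sum>i\<in>{1..<n}. a w i * \<Phi> w x i) = L w - l"
        unfolding a_def \<Phi>_def L_def l_def by (rule sum_chain_coords[OF n w])
      then have xC: "x \<in> C w \<longleftrightarrow> (\<forall>i\<in>{1..<n}. ?Q i) \<and> - R \<le> l"
        using x \<Phi>x \<Phi>D by (auto simp: C_def signed_simplex_def)
      \<comment> \<open>A factor is 1 minus the indicator of negative slack if \<open>a w i\<close>
        is positive, and minus that indicator otherwise: in both cases the sign of
        \<open>a w i\<close> times the cone condition.\<close>
      have "(\<Prod>i\<in>{1..<n}. of_bool (lam (w (i + 1)) < lam (w i)) - of_bool (D (w ` {1..i}) < 0)) =
          (\<Prod>i\<in>{1..<n}. sgn (a w i) * (of_bool (?Q i) :: real))"
      proof (intro prod.cong refl)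
        fix i assume "i \<in> {1..<n}"
        then have "a w i \<noteq> 0" using a0[OF w] by blast
        then show "of_bool (lam (w (i + 1)) < lam (w i)) - of_bool (D (w ` {1..i}) < 0) =
            sgn (a w i) * (of_bool (?Q i) :: real)"
          by (auto simp: a_def sgn_if)
      qed
      also have "\<dots> = (\<Prod>i\<in>{1..<n}. sgn (a w i)) * of_bool (\<forall>i\<in>{1..<n}. ?Q i)"
        unfolding prod.distrib
        by (cases "\<forall>i\<in>{1..<n}. ?Q i") (auto simp: of_bool_def intro!: prod_zero prod.neutral)
      finally show "(\<Prod>i\<in>{1..<n}.
          of_bool (lam (w (i + 1)) < lam (w i)) - of_bool (D (w ` {1..i}) < 0)) * of_bool (- R \<le> l) = ?f w"
        by (simp add: indicator_def xC)
    qed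
    finally show ?thesis .
  qed
  have "Vol n (gen_permutohedron n y) = measure ?M (P \<inter> space ?M)"
    unfolding Vol_def P_def[symmetric] by (rule arg_cong[where f = "measure ?M"]) (auto simp: P_eq)
  also have "\<dots> = (\<integral>x. indicator P x \<partial>?M)" by (rule Bochner_Integration.integral_indicator[symmetric])
  also have "\<dots> = (\<integral>x. (\<Sum>w | w permutes ?G. (\<Prod>i\<in>{1..<n}. sgn (a w i)) * indicator (C w) x) \<partial>?M)"
    by (intro Bochner_Integration.integral_cong refl ind)
  also have "\<dots> = (\<Sum>w | w permutes ?G. \<integral>x. (\<Prod>i\<in>{1..<n}. sgn (a w i)) * indicator (C w) x \<partial>?M)"
    using C by (intro Bochner_Integration.integral_sum integrable_mult_right integrable_real_indicator) auto
  also have "\<dots> = (\<Sum>w | w permutes ?G. (\<Prod>i\<in>{1..<n}. sgn (a w i)) * measure ?M (C w))"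
    by (intro sum.cong refl) (auto simp: C_def Int_assoc)
  also have "\<dots> = (\<Sum>w | w permutes ?G. 1 / fact (n - 1) * ((R + L w) ^ (n - 1) / (\<Prod>i\<in>{1..<n}. a w i)))"
  proof (intro sum.cong refl)
    fix w assume "w \<in> {w. w permutes ?G}"
    then have w: "w permutes ?G" by simp
    have "measure ?M (C w) = (R + L w) ^ (n - 1) / (fact (n - 1) * (\<Prod>i\<in>{1..<n}. \<bar>a w i\<bar>))"
      using R2[OF w] unfolding measure_def C(2)[OF w]
      by (intro enn2real_ennreal divide_nonneg_nonneg mult_nonneg_nonneg prod_nonneg zero_le_power)
        (auto simp: L_def)
    \<comment> \<open>The signs absorb the absolute values in the simplex volumes, leaving the
      signed denominators of the formula.\<close>
    moreover have "(\<Prod>i\<in>{1..<n}. sgn (a w i)) / (\<Prod>i\<in>{1..<n}. \<bar>a w i\<bar>) = 1 / (\<Prod>i\<in>{1..<n}. a w i)"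
    proof -
      have "(\<Prod>i\<in>{1..<n}. sgn (a w i) / \<bar>a w i\<bar>) = (\<Prod>i\<in>{1..<n}. 1 / a w i)"
        by (intro prod.cong) (auto simp: sgn_if)
      then show ?thesis by (simp add: prod_dividef)
    qed
    moreover have "s * (K / (f * b)) = 1 / f * (K * (s / b))" for s K f b :: real
      by (simp add: ac_simps)
    moreover have "K * (1 / b) = K / b" for K b :: real by simp
    ultimately show "(\<Prod>i\<in>{1..<n}. sgn (a w i)) * measure ?M (C w) =
        1 / fact (n - 1) * ((R + L w) ^ (n - 1) / (\<Prod>i\<in>{1..<n}. a w i))"
      by (simp only:)
  qed
  finally show ?thesis unfolding L_def a_def by (simp only: sum_distrib_left)
qed

theorem theorem10p1:
  fixes n :: nat and y :: "nat set \<Rightarrow> real" and lam :: "nat \<Rightarrow> real"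
  assumes "n \<ge> 1"
    and "\<And>I. I \<in> nonempty_subsets n \<Longrightarrow> y I \<ge> 0"
    and "inj_on lam {1..n}"
  shows "Vol n (gen_permutohedron n y) =
    1 / fact (n - 1) *
    (\<Sum>w | w permutes {1..n}.
       (\<Sum>I\<in>nonempty_subsets n. lam (w (Min I)) * y (w ` I)) ^ (n - 1) /
       (\<Prod>i\<in>{1..<n}. lam (w i) - lam (w (i + 1))))"
proof -
  define L where "L w = (\<Sum>I\<in>nonempty_subsets n. lam (w (Min I)) * y (w ` I))" for w
  define A where "A w = (\<Prod>i\<in>{1..<n}. lam (w i) - lam (w (i + 1)))" for w
  \<comment> \<open>The difference of the two sides of \<open>Vol_eq_truncated\<close> as a
    polynomial in \<open>R\<close>; \<open>[:L w, 1:]\<close> is the linear polynomial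
    \<open>R + L w\<close>.\<close>
  define p where "p = smult (1 / fact (n - 1)) (\<Sum>w | w permutes {1..n}. smult (1 / A w) ([:L w, 1:] ^ (n - 1)))
     - [:Vol n (gen_permutohedron n y):]"
  have poly_p: "poly p R = 1 / fact (n - 1) * (\<Sum>w | w permutes {1..n}. (R + L w) ^ (n - 1) / A w)
      - Vol n (gen_permutohedron n y)" for R
    by (simp add: p_def poly_sum add.commute)
  \<comment> \<open>The first summand lets the half-space contain the polytope; the second makes
    every \<open>R + L w\<close> nonnegative.\<close>
  define R0 where "R0 = (\<Sum>j\<in>{1..n}. \<bar>lam j\<bar>) * hit_weight n y {1..n} + (\<Sum>w | w permutes {1..n}. \<bar>L w\<bar>)"
  have fin: "finite {w. w permutes {1..n}}" by (rule finite_permutations) simp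
  have "poly p R = 0" if R: "R0 \<le> R" for R
  proof -
    have c: "0 \<le> hit_weight n y {1..n}"
      unfolding hit_weight_full using assms(2) by (rule sum_nonneg)
    have Lw: "\<bar>L w\<bar> \<le> (\<Sum>w | w permutes {1..n}. \<bar>L w\<bar>)" if "w permutes {1..n}" for w
      using fin that by (intro member_le_sum) auto
    have "0 \<le> (\<Sum>w | w permutes {1..n}. \<bar>L w\<bar>)" by (rule sum_nonneg) simp
    moreover have "0 \<le> (\<Sum>j\<in>{1..n}. \<bar>lam j\<bar>) * hit_weight n y {1..n}"
      using c by (intro mult_nonneg_nonneg sum_nonneg) auto
    ultimately have R1: "(\<Sum>j\<in>{1..n}. \<bar>lam j\<bar>) * hit_weight n y {1..n} \<le> R"
      and R': "(\<Sum>w | w permutes {1..n}. \<bar>L w\<bar>) \<le> R"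
      using R unfolding R0_def by linarith+
    have R2: "0 \<le> R + L w" if "w permutes {1..n}" for w
      using R' Lw[OF that] by linarith
    show ?thesis
      unfolding poly_p L_def A_def
      using Vol_eq_truncated[OF assms R1 R2[unfolded L_def]] by simp
  qed
  \<comment> \<open>A polynomial vanishing on a whole ray is zero, so the identity extends to
    \<open>R = 0\<close>, where the truncation itself need not be valid.\<close>
  then have "{R0..} \<subseteq> {R. poly p R = 0}" by auto
  then have "infinite {R. poly p R = 0}" using infinite_Ici[of R0] finite_subset by blast
  then have "p = 0" using poly_roots_finite by blast
  then show ?thesis using poly_p[of 0] by (simp add: L_def A_def)
qed

end
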